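(* Let $B\subset\mathbb R$ be a compact interval and let $\varphi:B\to\mathbb S^n$ be a $C^{1+\varepsilon}$-map for some $\varepsilon>0$ such that $\dot\varphi$ does not vanish on $B$. Then the following hold. (1) The Hausdorff dimension of the set of points $s\in B$ such that $\varphi(s)$ is intrinsically singular on average is at most $1/2$. (2) The set of points $s\in B$ for which $\varphi(s)$ is intrinsically badly approximable is winning for a Schmidt game on $B$. In particular, this set is thick in $B$. (3) For every $\gamma>0$, the set of points $s\in B$ for which $\varphi(s)\in A(\phi_{1+\gamma},\mathbb S^n)$ has Lebesgue measure $0$.
   Context: $\mathbb S^n\subset\mathbb R^{n+1}$ is the unit sphere. A $C^{1+\varepsilon}$-map is a $C^1$ map whose derivative is $\varepsilon$-Hölder. For $\phi:\mathbb N\to(0,\infty)$, $A(\phi,\mathbb S^n)$ is the set of $\mathbf x\in\mathbb S^n$ for which there exist infinitely many $(\mathbf p,q)\in\mathbb Z^{n+1}\times\mathbb N$ with $\mathbf p/q\in\mathbb S^n$ and $\|\mathbf x-\mathbf p/q\|<\phi(q)$. For $\tau>0$, $\phi_\tau(x)=x^{-\tau}$. A point $\mathbf x\in\mathbb S^n$ is (intrinsically) badly approximable if there is $\epsilon(\mathbf x)>0$ with $\mathbf x\notin A(\epsilon(\mathbf x)\phi_1,\mathbb S^n)$. It is intrinsically singular on average if for all $\epsilon>0$, $$\lim_{N\to\infty}\frac1N\#\Big\{1\le\ell\le N:\ \exists(\mathbf p,q)\in\mathbb Z^{n+1}\times\mathbb N,\ \mathbf p/q\in\mathbb S^n,\ \Big\|\mathbf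 x-\frac{\mathbf p}q\Big\|<\epsilon2^{-\ell},\ 0<|q|\le2^\ell\Big\}=1.$$ A subset of a metric space is thick if its intersection with every non-empty open set has full Hausdorff dimension. Modified Schmidt game on a compact interval $I_0\subset\mathbb R$ with parameter $\sigma>0$: let $\Phi_t(x)=e^{-\sigma t}x$. Given $a,b>0$, Bob first picks $t_0>0$ and $x_1\in\mathbb R$ so that $B_1=\Phi_{t_0}(I_0)+x_1\subset I_0$. Then Alice picks a translate $A_1$ of $\Phi_a(B_1)$ contained in $B_1$, Bob picks a translate $B_2$ of $\Phi_b(A_1)$ contained in $A_1$, and so on (Alice's $A_k\subset B_k$ is a translate of $\Phi_a(B_k)$ and Bob's $B_{k+1}\subset A_k$ is a translate of $\Phi_b(A_k)$). The intersection $\bigcap_kA_k=\bigcap_kB_k$ is a single point. A set $S\subseteq\mathbb R$ is $(a,b)$-winning if Alice can always play so that this point lies in $S$, no matter how Bob plays; $a$-winning if it is $(a,b)$-winning for all $b>0$; winning if it is $a$-winning for some $a>0$. (Changing $\sigma$ only rescales $a$ and $b$, so the notion "winning" does not depend on $\sigma$.) A Schmidt game on $B$ is this game with $I_0=B$. *)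

theory Defs
  imports "HOL-Analysis.Analysis"
begin

text \<open>The sphere \<open>S\<^sup>n \<subset> \<real>\<^sup>n\<^sup>+\<^sup>1\<close> is \<open>sphere 0 1\<close> in \<open>real ^ 'm\<close>, where \<open>CARD('m) = n + 1\<close>.\<close>

text \<open>The convention is \<open>0\<^sup>0 = 1\<close> on nonempty sets, so that the \<open>0\<close>-dimensional measure
  counts points; \<open>powr\<close> alone would give \<open>0\<close>.\<close>

definition diam_pow :: "real \<Rightarrow> 'a::metric_space set \<Rightarrow> ennreal" where
  "diam_pow d U =
     (if U = {} then 0 else if d = 0 then 1 else ennreal (diameter U powr d))"

text \<open>Covering sets are required to be bounded because \<open>diameter\<close> is unspecified on unbounded
  sets. Finite covers are included, by padding with empty sets.\<close>

definition hausdorff_content :: "real \<Rightarrow> real \<Rightarrow> 'a::metric_space set \<Rightarrow> ennreal" where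
  "hausdorff_content d \<delta> S =
     (INF U \<in> {U :: nat \<Rightarrow> 'a set. S \<subseteq> (\<Union>i. U i) \<and> (\<forall>i. bounded (U i) \<and> diameter (U i) \<le> \<delta>)}.
        \<Sum>i. diam_pow d (U i))"

definition hausdorff_measure :: "real \<Rightarrow> 'a::metric_space set \<Rightarrow> ennreal" where
  "hausdorff_measure d S = (SUP \<delta>\<in>{0<..}. hausdorff_content d \<delta> S)"

definition hausdorff_dim :: "'a::metric_space set \<Rightarrow> ennreal" where
  "hausdorff_dim S = Inf {ennreal d | d. 0 \<le> d \<and> hausdorff_measure d S = 0}"

text \<open>\<open>S\<close> is thick in the metric space \<open>X\<close>; full dimension means the dimension of \<open>X\<close>.\<close>

definition thick_in :: "'a::metric_space set \<Rightarrow> 'a set \<Rightarrow> bool" where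
  "thick_in X S \<longleftrightarrow> S \<subseteq> X \<and>
     (\<forall>U. openin (top_of_set X) U \<and> U \<noteq> {} \<longrightarrow> hausdorff_dim (S \<inter> U) = hausdorff_dim X)"

text \<open>One-sided derivatives are used at the end points of an interval \<open>B\<close>.\<close>

definition C1_holder_on :: "real \<Rightarrow> real set \<Rightarrow> (real \<Rightarrow> 'a::real_normed_vector) \<Rightarrow> bool" where
  "C1_holder_on \<epsilon> B f \<longleftrightarrow>
     f differentiable_on B \<and>
     continuous_on B (\<lambda>s. vector_derivative f (at s within B)) \<and>
     (\<exists>C. \<forall>s\<in>B. \<forall>t\<in>B.
        norm (vector_derivative f (at s within B) - vector_derivative f (at t within B))
          \<le> C * \<bar>s - t\<bar> powr \<epsilon>)"

definition rat_point :: "int ^ 'm \<Rightarrow> nat \<Rightarrow> real ^ 'm" where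
  "rat_point p q = (\<chi> i. real_of_int (p $ i) / real q)"

text \<open>Approximants are counted as pairs \<open>(p, q)\<close>, not as rational points, and need not be in
  lowest terms. In particular every rational point is approximable for every positive \<open>\<psi>\<close>.\<close>

definition approximable :: "(nat \<Rightarrow> real) \<Rightarrow> (real ^ 'm) set" where
  "approximable \<psi> = {x \<in> sphere 0 1.
     infinite {(p :: int ^ 'm, q :: nat).
       q > 0 \<and> rat_point p q \<in> sphere 0 1 \<and> norm (x - rat_point p q) < \<psi> q}}"

definition phi :: "real \<Rightarrow> nat \<Rightarrow> real" where
  "phi \<tau> q = real q powr (- \<tau>)"

definition badly_approximable :: "real ^ 'm \<Rightarrow> bool" where
  "badly_approximable x \<longleftrightarrow>
     x \<in> sphere 0 1 \<and> (\<exists>\<epsilon>>0. x \<notin> approximable (\<lambda>q. \<epsilon> * phi 1 q))"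

definition singular_on_average :: "real ^ 'm \<Rightarrow> bool" where
  "singular_on_average x \<longleftrightarrow> x \<in> sphere 0 1 \<and>
     (\<forall>\<epsilon>>0.
       (\<lambda>N. real (card {l \<in> {1..N}. \<exists>(p :: int ^ 'm) (q :: nat).
               rat_point p q \<in> sphere 0 1 \<and> norm (x - rat_point p q) < \<epsilon> * 2 powr (- real l) \<and>
               0 < q \<and> q \<le> 2 ^ l}) / real N) \<longlonglongrightarrow> 1)"

text \<open>\<open>D\<close> is a translate of \<open>\<Phi>\<^sub>t(C)\<close> contained in \<open>C\<close>, where \<open>\<Phi>\<^sub>t(x) = e\<^sup>-\<^sup>\<sigma>\<^sup>t x\<close>.\<close>

definition legal_move :: "real \<Rightarrow> real \<Rightarrow> real set \<Rightarrow> real set \<Rightarrow> bool" where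
  "legal_move \<sigma> t C D \<longleftrightarrow> (\<exists>x. D = (\<lambda>y. exp (- \<sigma> * t) * y + x) ` C) \<and> D \<subseteq> C"

text \<open>A strategy \<open>f\<close> of Alice maps the list of all previous moves of Bob to her next move.
  Indices start at \<open>0\<close>: Bob's first move is \<open>B 0\<close>, answered by \<open>alice f B 0\<close>.\<close>

definition alice :: "(real set list \<Rightarrow> real set) \<Rightarrow> (nat \<Rightarrow> real set) \<Rightarrow> nat \<Rightarrow> real set" where
  "alice f B k = f (map B [0..<Suc k])"

definition bob_legal_upto ::
    "real \<Rightarrow> real \<Rightarrow> real set \<Rightarrow> (real set list \<Rightarrow> real set) \<Rightarrow> (nat \<Rightarrow> real set) \<Rightarrow> nat \<Rightarrow> bool" where
  "bob_legal_upto \<sigma> b I\<^sub>0 f B n \<longleftrightarrow>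
     (\<exists>t>0. legal_move \<sigma> t I\<^sub>0 (B 0)) \<and>
     (\<forall>k<n. legal_move \<sigma> b (alice f B k) (B (Suc k)))"

text \<open>Alice has to answer legally as long as Bob has played legally so far. It is not enough to
  consider infinite plays in which Bob is always legal: Alice could otherwise win by making a move
  to which Bob has no legal answer.\<close>

definition ab_winning :: "real \<Rightarrow> real set \<Rightarrow> real \<Rightarrow> real \<Rightarrow> real set \<Rightarrow> bool" where
  "ab_winning \<sigma> I\<^sub>0 a b S \<longleftrightarrow>
     (\<exists>f. \<forall>B.
        (\<forall>n. bob_legal_upto \<sigma> b I\<^sub>0 f B n \<longrightarrow> legal_move \<sigma> a (B n) (alice f B n)) \<and>
        ((\<forall>n. bob_legal_upto \<sigma> b I\<^sub>0 f B n) \<longrightarrow> (\<exists>x\<in>S. (\<Inter>k. alice f B k) = {x})))"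

definition a_winning :: "real \<Rightarrow> real set \<Rightarrow> real \<Rightarrow> real set \<Rightarrow> bool" where
  "a_winning \<sigma> I\<^sub>0 a S \<longleftrightarrow> (\<forall>b>0. ab_winning \<sigma> I\<^sub>0 a b S)"

definition schmidt_winning :: "real \<Rightarrow> real set \<Rightarrow> real set \<Rightarrow> bool" where
  "schmidt_winning \<sigma> I\<^sub>0 S \<longleftrightarrow> (\<exists>a>0. a_winning \<sigma> I\<^sub>0 a S)"

end

theory Submission
  imports Defs
begin

text \<open>Everything rests on one fact: distinct rational points \<open>P = p/q\<close> and \<open>P' = p'/q'\<close> of the sphere
  satisfy \<open>q q' |P - P'|\<^sup>2 \<ge> 2\<close> (\<open>rat_point_separation\<close>). Rational points of height at most \<open>H\<close> are
  thus \<open>1/H\<close>-separated, which is the order of the radii \<open>\<epsilon>/q\<close>. The curve enters only through being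
  bi-Lipschitz on short intervals (\<open>C1_imp_locally_bilipschitz\<close>): a piece of the curve over a short interval of
  length \<open>r\<close> comes close to at most one rational point with height below \<open>c/r\<close>, for a small constant
  \<open>c\<close>. Hence, in such an interval, the parameters that are too close to rational points with heights
  in a window \<open>[c/(R r), c/r)\<close> form one short cluster (\<open>danger_clusters\<close>).

  For the first claim, suppose that a rational point is a good approximation on the levels \<open>l\<close> to \<open>b\<close>, and
  not on level \<open>b + 1\<close>. Separation keeps all other rational points so far away that no level from
  \<open>b + 1\<close> to \<open>2 b + 1 - l\<close> is good. Every run of good levels is thus followed by a gap of at least
  the same length, and the good levels cannot have density \<open>1\<close>. Only the case remains in which the point is
  itself rational and the run is infinite, so that the parameters in question are countably many.

  For the second claim, Alice moves to the first or to the last quarter of Bob's interval; when the interval is short,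
  the current danger zone meets at most one of them. The lower bound for the dimension comes from the same
  danger zones: among the \<open>N\<close> cells of an interval, at most two are spoilt, and a greedy choice of cells
  also escapes any cover of small \<open>d\<close>-dimensional weight, as long as \<open>2 N\<^sup>d \<le> N - 2\<close>
  (\<open>point_avoiding_obstructions_and_cover\<close>). For \<open>d < 1\<close> this holds for large \<open>N\<close>.

  For the third claim, the radius \<open>q\<^sup>-\<^sup>1\<^sup>-\<^sup>\<gamma>\<close> makes the danger zones of the dyadic windows of heights so
  small that the sum of their measures converges.\<close>

section \<open>Rational points on the sphere\<close>

text \<open>The squared distance of two unit vectors is \<open>2 - 2 x \<bullet> y\<close>, so the integer \<open>q q' - p \<bullet> p'\<close> is
  positive, and hence at least \<open>1\<close>. On the real line, \<open>1 / (q q')\<close> bounds the distance and not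
  its square; this is why the critical exponent is \<open>2\<close> there and \<open>1\<close> on the sphere.\<close>

lemma rat_point_separation:
  assumes P: "rat_point p q \<in> sphere 0 1" "q > 0" and P': "rat_point p' q' \<in> sphere 0 1" "q' > 0"
    and ne: "rat_point p q \<noteq> (rat_point p' q' :: real ^ 'm)"
  shows "2 \<le> real q * real q' * (norm (rat_point p q - rat_point p' q' :: real ^ 'm))\<^sup>2"
proof -
  define k where "k = (\<Sum>i\<in>UNIV. p $ i * p' $ i)"
  have ip: "(rat_point p q :: real ^ 'm) \<bullet> rat_point p' q' = real_of_int k / (real q * real q')"
    by (simp add: inner_vec_def rat_point_def k_def sum_divide_distrib)
  have "(norm (rat_point p q - rat_point p' q' :: real ^ 'm))\<^sup>2 =
      2 - 2 * ((rat_point p q :: real ^ 'm) \<bullet> rat_point p' q')"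
    using P P' by (simp add: norm_eq_1 power2_norm_eq_inner inner_diff inner_commute)
  then have eq: "real q * real q' * (norm (rat_point p q - rat_point p' q' :: real ^ 'm))\<^sup>2 =
      2 * (real q * real q' - real_of_int k)"
    using P P' unfolding ip by (simp add: field_simps)
  moreover have "0 < real q * real q' * (norm (rat_point p q - rat_point p' q' :: real ^ 'm))\<^sup>2"
    using P P' ne by simp
  ultimately have "real_of_int k < real_of_int (int q * int q')" by simp
  then have "k + 1 \<le> int q * int q'" by linarith
  then have "real_of_int (k + 1) \<le> real_of_int (int q * int q')" by linarith
  then show ?thesis unfolding eq by simp
qed

lemma rat_point_eqI:
  assumes "rat_point p q \<in> sphere 0 1" "q > 0" and "rat_point p' q' \<in> sphere 0 1" "q' > 0"
    and "real q \<le> H" "real q' \<le> H" and near: "norm (rat_point p q - rat_point p' q' :: real ^ 'm) \<le> 1 / H"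
  shows "rat_point p q = (rat_point p' q' :: real ^ 'm)"
proof (rule ccontr)
  let ?d = "norm (rat_point p q - rat_point p' q' :: real ^ 'm)"
  assume "rat_point p q \<noteq> (rat_point p' q' :: real ^ 'm)"
  then have "2 \<le> real q * real q' * ?d\<^sup>2"
    using rat_point_separation assms by blast
  also have "\<dots> \<le> H * H * (1 / H)\<^sup>2"
    using assms by (intro mult_mono power_mono) auto
  also have "\<dots> \<le> 1" by (simp add: power2_eq_square)
  finally show False by simp
qed

lemma finite_bounded_int_vec: "finite {p :: int ^ 'm. \<forall>i. \<bar>p $ i\<bar> \<le> K}"
proof -
  have "finite (vec_lambda ` (UNIV \<rightarrow>\<^sub>E {-K..K}) :: (int ^ 'm) set)"
    by (intro finite_imageI finite_PiE) auto
  moreover have "{p :: int ^ 'm. \<forall>i. \<bar>p $ i\<bar> \<le> K} \<subseteq> vec_lambda ` (UNIV \<rightarrow>\<^sub>E {-K..K})"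
  proof
    fix p :: "int ^ 'm" assume "p \<in> {p. \<forall>i. \<bar>p $ i\<bar> \<le> K}"
    then have "vec_nth p \<in> UNIV \<rightarrow>\<^sub>E {-K..K}" by (auto simp: abs_le_iff minus_le_iff)
    moreover have "p = vec_lambda (vec_nth p)" by (simp add: vec_nth_inverse)
    ultimately show "p \<in> vec_lambda ` (UNIV \<rightarrow>\<^sub>E {-K..K})" by blast
  qed
  ultimately show ?thesis by (rule rev_finite_subset)
qed

lemma finite_rat_points_bounded_height:
  "finite {(p :: int ^ 'm, q :: nat). q > 0 \<and> q \<le> Q \<and> rat_point p q \<in> (sphere 0 1 :: (real ^ 'm) set)}"
proof (rule finite_subset)
  show "finite ({p :: int ^ 'm. \<forall>i. \<bar>p $ i\<bar> \<le> int Q} \<times> {..Q})"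
    using finite_bounded_int_vec by blast
  show "{(p :: int ^ 'm, q :: nat). q > 0 \<and> q \<le> Q \<and> rat_point p q \<in> (sphere 0 1 :: (real ^ 'm) set)}
      \<subseteq> {p :: int ^ 'm. \<forall>i. \<bar>p $ i\<bar> \<le> int Q} \<times> {..Q}"
  proof clarsimp
    fix p :: "int ^ 'm" and q :: nat and i
    assume *: "0 < q" "q \<le> Q" "norm (rat_point p q :: real ^ 'm) = 1"
    have "\<bar>(rat_point p q :: real ^ 'm) $ i\<bar> \<le> 1"
      using component_le_norm_cart[of "rat_point p q :: real ^ 'm" i] *(3) by simp
    then have "\<bar>real_of_int (p $ i)\<bar> \<le> real q"
      using *(1) by (simp add: rat_point_def)
    then show "\<bar>p $ i\<bar> \<le> int Q" using *(2) by linarith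
  qed
qed

text \<open>Points of the sphere have bounded numerators for bounded denominators, so that infinitely many
  pairs force the denominators to be unbounded.\<close>

lemma approximable_large_height:
  fixes x :: "real ^ 'm"
  assumes "x \<in> approximable \<psi>"
  shows "\<exists>(p :: int ^ 'm) q. q > Q \<and> rat_point p q \<in> (sphere 0 1 :: (real ^ 'm) set)
     \<and> norm (x - rat_point p q) < \<psi> q"
proof (rule ccontr)
  assume no: "\<not> ?thesis"
  have "{(p :: int ^ 'm, q :: nat). q > 0 \<and> rat_point p q \<in> (sphere 0 1 :: (real ^ 'm) set)
          \<and> norm (x - rat_point p q) < \<psi> q}
      \<subseteq> {(p, q). q > 0 \<and> q \<le> Q \<and> rat_point p q \<in> (sphere 0 1 :: (real ^ 'm) set)}"
    using no by (clarsimp simp: not_less) (meson not_le)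
  then have "finite {(p :: int ^ 'm, q :: nat). q > 0 \<and> rat_point p q \<in> (sphere 0 1 :: (real ^ 'm) set)
          \<and> norm (x - rat_point p q) < \<psi> q}"
    by (rule finite_subset) (rule finite_rat_points_bounded_height)
  then show False using assms by (simp add: approximable_def)
qed

section \<open>Points that are singular on average\<close>

text \<open>Let \<open>e l\<close> be the end of the run that contains \<open>l\<close>. Reflection at the end of the run takes \<open>l\<close> to
  \<open>2 e l + 1 - l\<close> in the gap after it. If \<open>b\<close> is the end of a run, this injects the part of \<open>G\<close> in
  \<open>[1, b]\<close> into the complement of \<open>G\<close> in \<open>[1, 2 b]\<close>. Density \<open>1\<close> would give
  \<open>3 b \<le> 2 b + o(b)\<close> along these \<open>b\<close>.\<close>

lemma runs_followed_by_gaps: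
  fixes G :: "nat set"
  assumes run: "\<And>l. l \<in> G \<Longrightarrow> \<exists>b\<ge>l. {l..b} \<subseteq> G \<and> G \<inter> {b<..2 * b + 1 - l} = {}"
  shows "\<not> (\<lambda>N. real (card {l \<in> {1..N}. l \<in> G}) / real N) \<longlonglongrightarrow> 1"
proof
  define f where "f N = card {l \<in> {1..N}. l \<in> G}" for N
  assume "(\<lambda>N. real (card {l \<in> {1..N}. l \<in> G}) / real N) \<longlonglongrightarrow> 1"
  then have "\<forall>\<^sub>F N in sequentially. real (f N) / real N > 3 / 4"
    unfolding f_def by (rule order_tendstoD) simp
  then obtain N0 where N0: "\<And>N. N \<ge> N0 \<Longrightarrow> real (f N) / real N > 3 / 4"
    unfolding eventually_sequentially by blast
  have dens: "4 * f N > 3 * N" if "N \<ge> N0" for N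
  proof (cases "N = 0")
    case False
    then have "4 * real (f N) > 3 * real N" using N0[OF that] by (simp add: field_simps)
    then show ?thesis by linarith
  next
    case True then show ?thesis using N0[OF that] by simp
  qed
  have "\<exists>l\<in>G. l > N0"
  proof (rule ccontr)
    assume "\<not> ?thesis"
    then have "{l \<in> {1..4 * N0 + 4}. l \<in> G} \<subseteq> {1..N0}" by (auto simp: not_less)
    from card_mono[OF _ this] have "f (4 * N0 + 4) \<le> N0" unfolding f_def by simp
    then show False using dens[of "4 * N0 + 4"] by simp
  qed
  then obtain l0 where l0: "l0 \<in> G" "l0 > N0" by blast
  obtain e where e: "\<And>l. l \<in> G \<Longrightarrow> l \<le> e l \<and> {l..e l} \<subseteq> G \<and> G \<inter> {e l<..2 * e l + 1 - l} = {}"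
    using run by metis
  \<comment> \<open>The gap after the earlier run separates it from all later elements of \<open>G\<close>.\<close>
  have apart: "2 * e l + 1 - l < l'" if "l \<in> G" "l' \<in> G" "e l < e l'" for l l'
  proof (cases "l' \<le> e l")
    case True
    then have "Suc (e l) \<in> G" using e[OF that(2)] that(3) by auto
    moreover have "Suc (e l) \<in> {e l<..2 * e l + 1 - l}" using e[OF that(1)] by auto
    ultimately show ?thesis using e[OF that(1)] by blast
  next
    case False
    then have "l' \<notin> {e l<..2 * e l + 1 - l}" using e[OF that(1)] that(2) by blast
    then show ?thesis using False by simp
  qed
  define b where "b = e l0"
  have b: "b > N0" using e[OF l0(1)] l0(2) unfolding b_def by linarith
  let ?A = "{l \<in> {1..b}. l \<in> G}" and ?C = "{l \<in> {1..2 * b}. l \<in> G}"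
  have small: "e l \<le> b" if "l \<in> G" "l \<le> b" for l
  proof (rule ccontr)
    assume "\<not> e l \<le> b"
    then have "2 * b + 1 - l0 < l" using apart[OF l0(1) that(1)] unfolding b_def by simp
    then show False using that(2) e[OF l0(1)] unfolding b_def by linarith
  qed
  have "card ?A \<le> card ({1..2 * b} - ?C)"
  proof (rule card_inj_on_le)
    show "inj_on (\<lambda>l. 2 * e l + 1 - l) ?A"
    proof (rule inj_onI)
      fix l l' assume l: "l \<in> ?A" "l' \<in> ?A" and eq: "2 * e l + 1 - l = 2 * e l' + 1 - l'"
      have 1: "e l = e l'"
      proof (rule ccontr)
        assume "e l \<noteq> e l'"
        then consider "e l < e l'" | "e l' < e l" by linarith
        then show False
        proof cases
          case 1
          then have "2 * e l + 1 - l < l'" "l' \<le> e l'" using apart[of l l'] e[of l'] l by auto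
          then show False using eq by linarith
        next
          case 2
          then have "2 * e l' + 1 - l' < l" "l \<le> e l" using apart[of l' l] e[of l] l by auto
          then show False using eq by linarith
        qed
      qed
      have "l \<le> e l" "l' \<le> e l'" using e[of l] e[of l'] l by auto
      then show "l = l'" using 1 eq by linarith
    qed
    show "(\<lambda>l. 2 * e l + 1 - l) ` ?A \<subseteq> {1..2 * b} - ?C"
    proof (rule image_subsetI)
      fix l assume "l \<in> ?A"
      then have l: "l \<in> G" "1 \<le> l" "l \<le> b" by auto
      have *: "l \<le> e l" "e l \<le> b" "G \<inter> {e l<..2 * e l + 1 - l} = {}"
        using e[OF l(1)] small[OF l(1) l(3)] by auto
      have "2 * e l + 1 - l \<in> {e l<..2 * e l + 1 - l}" using * by auto
      then have "2 * e l + 1 - l \<notin> G" using *(3) by blast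
      then show "2 * e l + 1 - l \<in> {1..2 * b} - ?C" using * l by auto
    qed
  qed simp
  also have "card ({1..2 * b} - ?C) = 2 * b - card ?C" by (subst card_Diff_subset) auto
  finally have "card ?A \<le> 2 * b - card ?C" .
  moreover have c: "card ?C \<le> 2 * b"
    using card_mono[of "{1..2 * b}" ?C] by (simp add: subset_iff)
  ultimately have "f b + f (2 * b) \<le> 2 * b"
    using c unfolding f_def by linarith
  then show False using dens[of b] dens[of "2 * b"] b by linarith
qed

text \<open>Let \<open>P = p/q\<close> witness level \<open>l\<close>, and let \<open>b\<close> be the last level with \<open>|x - P| < \<epsilon> / 2 ^ b\<close>; it
  exists unless \<open>x = P\<close>. Then \<open>P\<close> witnesses all levels from \<open>l\<close> to \<open>b\<close>. A witness \<open>P' = p'/q'\<close> of a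
  level \<open>k > b\<close> is another point, at distance at most \<open>3/2 \<epsilon> / 2 ^ b\<close> from \<open>P\<close>, so that
  separation and the bounds \<open>q \<le> 2 ^ l\<close> and \<open>q' \<le> 2 ^ k\<close> give \<open>9/8 \<epsilon>\<^sup>2 2 ^ (l + k) \<ge> 2 ^ (2 b)\<close>. For
  \<open>\<epsilon> = 1/2\<close> this means \<open>k > 2 b + 1 - l\<close>.\<close>

lemma singular_on_average_imp_rational:
  fixes x :: "real ^ 'm"
  assumes "singular_on_average x"
  shows "\<exists>(p :: int ^ 'm) q. x = rat_point p q"
proof (rule ccontr)
  assume irrational: "\<not> ?thesis"
  define wit where "wit l p q \<longleftrightarrow> rat_point p q \<in> (sphere 0 1 :: (real ^ 'm) set) \<and>
    norm (x - rat_point p q) < (1 / 2) / 2 ^ l \<and> 0 < q \<and> q \<le> 2 ^ l" for l and p :: "int ^ 'm" and q :: nat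
  define G where "G = {l. \<exists>p q. wit l p q}"
  have half_scale: "(1 / 2) / 2 ^ l = 1 / 2 * 2 powr (- real l)" for l
    by (simp add: powr_minus_divide powr_realpow)
  have lim: "(\<lambda>N. real (card {l \<in> {1..N}. l \<in> G}) / real N) \<longlonglongrightarrow> 1"
    unfolding G_def wit_def half_scale mem_Collect_eq
    by (rule assms[unfolded singular_on_average_def, THEN conjunct2, rule_format]) simp
  have "\<exists>b\<ge>l. {l..b} \<subseteq> G \<and> G \<inter> {b<..2 * b + 1 - l} = {}" if lG: "l \<in> G" for l
  proof -
    obtain p q where w: "wit l p q" using lG unfolding G_def by blast
    define P where "P = (rat_point p q :: real ^ 'm)"
    have pos: "norm (x - P) > 0" using irrational unfolding P_def by simp
    define K where "K = {b. norm (x - P) < (1 / 2) / 2 ^ b}"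
    obtain n where n: "1 / norm (x - P) < 2 ^ n" using real_arch_pow[of 2] by auto
    have "b \<le> n" if "b \<in> K" for b
    proof (rule ccontr)
      assume "\<not> b \<le> n"
      then have "(2::real) ^ n \<le> 2 ^ b" by simp
      moreover have "2 ^ b < 1 / norm (x - P)"
        using that pos unfolding K_def by (simp add: field_simps)
      ultimately show False using n by linarith
    qed
    then have fin: "finite K" by (meson finite_nat_set_iff_bounded_le)
    have lK: "l \<in> K" using w unfolding K_def wit_def P_def by simp
    define b where "b = Max K"
    have b: "b \<in> K" "l \<le> b" "Suc b \<notin> K"
      using Max_in[OF fin] Max_ge[OF fin] lK unfolding b_def by (auto, force)
    have "{l..b} \<subseteq> G"
    proof
      fix k assume k: "k \<in> {l..b}"
      have "norm (x - P) < (1 / 2) / 2 ^ b" using b(1) unfolding K_def by simp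
      also have "\<dots> \<le> (1 / 2) / 2 ^ k" using k by (intro divide_left_mono) auto
      finally have 1: "norm (x - P) < (1 / 2) / 2 ^ k" .
      have "q \<le> 2 ^ l" using w unfolding wit_def by simp
      also have "\<dots> \<le> 2 ^ k" using k by simp
      finally have "wit k p q" using w 1 unfolding wit_def P_def by simp
      then show "k \<in> G" unfolding G_def by blast
    qed
    moreover have "G \<inter> {b<..2 * b + 1 - l} = {}"
    proof (rule ccontr)
      assume "G \<inter> {b<..2 * b + 1 - l} \<noteq> {}"
      then obtain k where k: "k \<in> G" "b < k" "k \<le> 2 * b + 1 - l" by auto
      then obtain p' q' where w': "wit k p' q'" unfolding G_def by blast
      define P' where "P' = (rat_point p' q' :: real ^ 'm)"
      have half: "(1 / 2) / 2 ^ k \<le> (1 / 2) / (2::real) ^ Suc b"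
        using k by (intro divide_left_mono power_increasing) auto
      have 1: "norm (x - P') < (1 / 2) / 2 ^ Suc b"
        using w' half unfolding wit_def P'_def by linarith
      have 2: "norm (x - P) < (1 / 2) / 2 ^ b" "norm (x - P) \<ge> (1 / 2) / 2 ^ Suc b"
        using b unfolding K_def by auto
      have ne: "P \<noteq> P'" using 1 2 by auto
      have "norm (P - P') \<le> norm (x - P) + norm (x - P')"
        using norm_triangle_ineq4[of "x - P'" "x - P"] by (simp add: algebra_simps)
      then have d: "norm (P - P') \<le> 3 / 4 / 2 ^ b" using 1 2 by simp
      have "2 \<le> real q * real q' * (norm (P - P'))\<^sup>2"
        unfolding P_def P'_def
        by (rule rat_point_separation) (use w w' ne in \<open>auto simp: wit_def P_def P'_def\<close>)
      also have "\<dots> \<le> 2 ^ l * 2 ^ k * (3 / 4 / 2 ^ b)\<^sup>2"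
      proof -
        have "real q \<le> 2 ^ l" "real q' \<le> 2 ^ k"
          using w w' unfolding wit_def by simp_all
        then show ?thesis using d by (intro mult_mono power_mono) auto
      qed
      also have "\<dots> = 9 / 16 * (2 ^ (l + k) / 2 ^ (2 * b))"
        by (simp add: power_add power2_eq_square mult_2)
      also have "\<dots> \<le> 9 / 16 * (2 ^ (2 * b + 1) / 2 ^ (2 * b))"
        using k b by (intro mult_left_mono divide_right_mono power_increasing) auto
      finally show False by simp
    qed
    ultimately show ?thesis using b(2) by blast
  qed
  from runs_followed_by_gaps[OF this] lim show False by blast
qed

section \<open>Hausdorff measure and dimension\<close>

lemma hausdorff_dim_le:
  assumes "0 \<le> d" "hausdorff_measure d S = 0"
  shows "hausdorff_dim S \<le> ennreal d"
  unfolding hausdorff_dim_def using assms by (intro Inf_lower) auto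

lemma hausdorff_content_mono: "S \<subseteq> T \<Longrightarrow> hausdorff_content d \<delta> S \<le> hausdorff_content d \<delta> T"
  unfolding hausdorff_content_def by (rule INF_superset_mono) auto

lemma hausdorff_dim_mono:
  assumes "S \<subseteq> T"
  shows "hausdorff_dim S \<le> hausdorff_dim T"
proof -
  have "hausdorff_measure d S \<le> hausdorff_measure d T" for d
    unfolding hausdorff_measure_def using assms by (intro SUP_mono') (simp add: hausdorff_content_mono)
  then have "hausdorff_measure d S = 0" if "hausdorff_measure d T = 0" for d
    using that by (metis le_zero_eq)
  then show ?thesis unfolding hausdorff_dim_def by (intro Inf_superset_mono) blast
qed

lemma hausdorff_measure_countable:
  assumes "countable S" "d > 0"
  shows "hausdorff_measure d S = 0"
proof -
  have "hausdorff_content d \<delta> S \<le> 0" if "\<delta> > 0" for \<delta> :: real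
  proof -
    define U where "U i = (if S = {} then {} else {from_nat_into S i})" for i :: nat
    have "S \<subseteq> (\<Union>i. U i)"
      using assms(1) by (auto simp: U_def) (metis from_nat_into_surj)
    moreover have "bounded (U i) \<and> diameter (U i) \<le> \<delta>" "diam_pow d (U i) = 0" for i
      using that assms(2) by (auto simp: U_def diam_pow_def)
    ultimately have "hausdorff_content d \<delta> S \<le> (\<Sum>i. diam_pow d (U i))"
      unfolding hausdorff_content_def by (intro INF_lower) simp
    then show ?thesis using \<open>\<And>i. diam_pow d (U i) = 0\<close> by simp
  qed
  then show ?thesis unfolding hausdorff_measure_def by (simp add: SUP_eq_const bot_ennreal flip: le_zero_eq) (auto intro!: SUP_least)
qed

text \<open>Sets of diameter at most \<open>1\<close> only lose weight when the exponent grows. The passage to \<open>d'\<close> takes care of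
  \<open>d = 0\<close>, where sets are counted, by turning all weights into powers of diameters.\<close>

lemma hausdorff_null_imp_cover:
  assumes null: "hausdorff_measure d S = 0" and d: "0 \<le> d" "d \<le> d'" "0 < d'" and "\<eta> > 0"
  obtains U :: "nat \<Rightarrow> 'a::metric_space set" where
    "S \<subseteq> (\<Union>i. U i)" "\<And>i. bounded (U i)"
    "summable (\<lambda>i. diameter (U i) powr d')" "(\<Sum>i. diameter (U i) powr d') < \<eta>"
proof -
  have "hausdorff_content d 1 S \<le> hausdorff_measure d S"
    unfolding hausdorff_measure_def by (rule SUP_upper) simp
  then have "hausdorff_content d 1 S < ennreal \<eta>" using null \<open>\<eta> > 0\<close> by simp
  then obtain U where U: "S \<subseteq> (\<Union>i. U i)" "\<And>i. bounded (U i)" "\<And>i. diameter (U i) \<le> 1"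
      and sum: "(\<Sum>i. diam_pow d (U i)) < ennreal \<eta>"
    unfolding hausdorff_content_def INF_less_iff by blast
  have "ennreal (diameter (U i) powr d') \<le> diam_pow d (U i)" for i
    using d U(3)[of i] diameter_ge_0[OF U(2)[of i]] powr_mono'[of d d' "diameter (U i)"]
    by (cases "U i = {}") (auto simp: diam_pow_def powr_le1 ennreal_leI)
  then have "(\<Sum>i. ennreal (diameter (U i) powr d')) \<le> (\<Sum>i. diam_pow d (U i))"
    by (intro suminf_le) auto
  then have small: "(\<Sum>i. ennreal (diameter (U i) powr d')) < ennreal \<eta>" using sum by simp
  then have s: "summable (\<lambda>i. diameter (U i) powr d')"
    by (intro summable_suminf_not_top) (auto simp: top_unique)
  moreover have "(\<Sum>i. diameter (U i) powr d') < \<eta>"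
    using small s by (simp add: suminf_ennreal2 ennreal_less_iff suminf_nonneg)
  ultimately show thesis using that U by blast
qed

lemma hausdorff_dim_interval_le_1: "hausdorff_dim {a..b::real} \<le> 1"
proof (cases "a < b")
  case True
  have "hausdorff_measure d {a..b} = 0" if d: "d > 1" for d
  proof -
    have "hausdorff_content d \<delta> {a..b} \<le> 0" if "\<delta> > 0" for \<delta> :: real
    proof -
      have bound: "hausdorff_content d \<delta> {a..b} \<le> ennreal ((b - a) powr d * real n powr (1 - d))"
        if n: "n > 0" "(b - a) / real n \<le> \<delta>" for n :: nat
      proof -
        define h where "h = (b - a) / real n"
        have h: "h > 0" "h \<le> \<delta>" "h * real n = b - a" using n True unfolding h_def by simp_all
        define U where "U i = (if i < n then {a + real i * h..a + (real i + 1) * h} else {})" for i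
        have "{a..b} \<subseteq> (\<Union>i. U i)"
        proof
          fix x assume x: "x \<in> {a..b}"
          show "x \<in> (\<Union>i. U i)"
          proof (cases "x = b")
            case True
            \<comment> \<open>The floor below would give the index \<open>n\<close> for the right end point.\<close>
            then have "x \<in> U (n - 1)" using n h by (auto simp: U_def of_nat_diff algebra_simps)
            then show ?thesis by blast
          next
            case False
            define i where "i = nat \<lfloor>(x - a) / h\<rfloor>"
            have i: "real i \<le> (x - a) / h" "(x - a) / h < real i + 1"
              using x h unfolding i_def by (simp_all add: of_nat_nat)
            then have le: "a + real i * h \<le> x" "x \<le> a + (real i + 1) * h"
              using h(1) by (simp_all add: field_simps)
            have "real i * h < real n * h" using le x False h(3) by (simp add: mult.commute)
            then have "i < n" using h(1) by simp
            then have "x \<in> U i" using le unfolding U_def by simp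
            then show ?thesis by blast
          qed
        qed
        moreover have "bounded (U i) \<and> diameter (U i) \<le> \<delta>" for i
          using h \<open>\<delta> > 0\<close> by (auto simp: U_def algebra_simps)
        ultimately have "hausdorff_content d \<delta> {a..b} \<le> (\<Sum>i. diam_pow d (U i))"
          unfolding hausdorff_content_def by (intro INF_lower) simp
        also have "\<dots> = (\<Sum>i<n. diam_pow d (U i))"
          by (intro suminf_finite) (auto simp: U_def diam_pow_def)
        also have "\<dots> = (\<Sum>i<n. ennreal (h powr d))"
          using h d by (intro sum.cong) (auto simp: U_def diam_pow_def algebra_simps)
        also have "\<dots> = ennreal (real n * h powr d)"
          by (simp add: ennreal_mult' ennreal_of_nat_eq_real_of_nat)
        also have "real n * h powr d = (b - a) powr d * real n powr (1 - d)"
          using n True by (simp add: h_def powr_divide powr_diff)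
        finally show ?thesis .
      qed
      have "(\<lambda>n. real n powr (1 - d)) \<longlonglongrightarrow> 0"
        using d by (intro tendsto_neg_powr filterlim_real_sequentially) simp
      then have "(\<lambda>n. (b - a) powr d * real n powr (1 - d)) \<longlonglongrightarrow> (b - a) powr d * 0"
        by (intro tendsto_intros)
      then have "(\<lambda>n. ennreal ((b - a) powr d * real n powr (1 - d))) \<longlonglongrightarrow> ennreal 0"
        by (intro tendsto_ennrealI) simp
      moreover have "\<forall>\<^sub>F n in sequentially. hausdorff_content d \<delta> {a..b} \<le> ennreal ((b - a) powr d * real n powr (1 - d))"
      proof (rule eventually_sequentiallyI[of "Suc (nat \<lceil>(b - a) / \<delta>\<rceil>)"])
        fix n assume n: "Suc (nat \<lceil>(b - a) / \<delta>\<rceil>) \<le> n"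
        then have "(b - a) / \<delta> \<le> real n" by linarith
        then show "hausdorff_content d \<delta> {a..b} \<le> ennreal ((b - a) powr d * real n powr (1 - d))"
          using n \<open>\<delta> > 0\<close> by (intro bound) (auto simp: field_simps)
      qed
      ultimately show ?thesis by (metis ennreal_0 tendsto_lowerbound trivial_limit_sequentially)
    qed
    then show ?thesis unfolding hausdorff_measure_def
      by (simp add: SUP_eq_const bot_ennreal flip: le_zero_eq) (auto intro!: SUP_least)
  qed
  then have le: "hausdorff_dim {a..b} \<le> ennreal (1 + e)" if "e > 0" for e
    using that by (intro hausdorff_dim_le) simp_all
  show ?thesis
  proof (rule ennreal_le_epsilon)
    fix e :: real assume "0 < e"
    then show "hausdorff_dim {a..b} \<le> 1 + ennreal e"
      using le[of e] ennreal_plus[of 1 e] by simp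
  qed
next
  case False
  then have "{a..b} \<subseteq> {a}" by auto
  then have "countable {a..b}" by (rule countable_subset) simp
  then have "hausdorff_measure 1 {a..b} = 0" by (rule hausdorff_measure_countable) simp
  then show ?thesis using hausdorff_dim_le[of 1 "{a..b}"] by simp
qed

section \<open>Points outside a Cantor construction and a cover\<close>

text \<open>A set of diameter less than \<open>g\<close> cannot reach across a whole cell of length \<open>g\<close>, so the
  cells that it meets are equal or adjacent.\<close>

lemma few_cells_met:
  fixes x g :: real
  assumes "g > 0" and close: "\<And>s t. \<lbrakk>s \<in> E; t \<in> E; s \<in> {x..x + real N * g}; t \<in> {x..x + real N * g}\<rbrakk> \<Longrightarrow> \<bar>s - t\<bar> < g"
  shows "card {j. j < N \<and> {x + real j * g..x + real j * g + g} \<inter> E \<noteq> {}} \<le> 2"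
proof -
  let ?T = "{j. j < N \<and> {x + real j * g..x + real j * g + g} \<inter> E \<noteq> {}}"
  have adjacent: "j' \<le> Suc j" if j: "j \<in> ?T" "j' \<in> ?T" for j j'
  proof (rule ccontr)
    assume "\<not> j' \<le> Suc j"
    then have "real j + 2 \<le> real j'" by linarith
    then have far: "(real j + 2) * g \<le> real j' * g" using assms(1) by (intro mult_right_mono) auto
    have inside: "{x + real i * g..x + real i * g + g} \<subseteq> {x..x + real N * g}" if "i < N" for i
    proof -
      have "(real i + 1) * g \<le> real N * g" using that assms(1) by (intro mult_right_mono) auto
      moreover have "0 \<le> real i * g" using assms(1) by simp
      ultimately show ?thesis by (auto simp: algebra_simps)
    qed
    obtain s t where st: "s \<in> {x + real j * g..x + real j * g + g} \<inter> E" "t \<in> {x + real j' * g..x + real j' * g + g} \<inter> E"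
      using j by blast
    then have "\<bar>s - t\<bar> < g" using inside[of j] inside[of j'] j
      by (intro close) (simp_all only: Int_iff mem_Collect_eq subset_iff)
    then show False using st far by (auto simp: algebra_simps)
  qed
  show ?thesis
  proof (cases "?T = {}")
    case True then show ?thesis by (metis card.empty zero_le)
  next
    case False
    define m where "m = Min ?T"
    have m: "m \<in> ?T" using Min_in[of ?T] False unfolding m_def by simp
    have "?T \<subseteq> {m, Suc m}"
    proof
      fix j assume j: "j \<in> ?T"
      then have "m \<le> j" unfolding m_def by simp
      moreover have "j \<le> Suc m" using adjacent[OF m j] .
      ultimately show "j \<in> {m, Suc m}" by (simp add: le_Suc_eq)
    qed
    then have "card ?T \<le> card {m, Suc m}" by (intro card_mono) auto
    then show ?thesis by simp
  qed
qed

definition met_weight :: "(nat \<Rightarrow> real set) \<Rightarrow> (nat \<Rightarrow> real) \<Rightarrow> real set \<Rightarrow> real" where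
  "met_weight U w I = (\<Sum>i. if U i \<inter> I \<noteq> {} then w i else 0)"

lemma summable_met_weight:
  assumes "summable w" "\<And>i. 0 \<le> w i"
  shows "summable (\<lambda>i. if U i \<inter> I \<noteq> {} then w i else (0::real))"
  using assms by (intro summable_comparison_test'[OF assms(1)]) auto

lemma le_met_weight:
  assumes "summable w" "\<And>i. 0 \<le> w i" "U i \<inter> I \<noteq> {}"
  shows "w i \<le> met_weight U w I"
  using sum_le_suminf[OF summable_met_weight[OF assms(1,2), of U I], of "{i}"] assms(2,3)
  unfolding met_weight_def by simp

text \<open>Cut the interval into \<open>N\<close> cells. The obstruction spoils at most two of them. Every covering set that meets
  the interval has diameter less than a cell, because its own weight is below the bound on the
  total; so it meets at most two cells, and the met weights of all cells add up to at most twice that of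
  the interval. One of the at least \<open>N - 2\<close> unspoilt cells therefore has at most \<open>2 / (N - 2)\<close> of that
  weight, and \<open>2 / (N - 2) \<le> N\<^sup>-\<^sup>d\<close> is what is needed to repeat the step inside this cell.\<close>

lemma avoidance_step:
  fixes x h d :: real
  assumes h: "h > 0" and d: "d > 0" and N: "N > 2" "2 * real N powr d \<le> real N - 2"
    and w: "summable w" "\<And>i. 0 \<le> w i" "\<And>i. bounded (U i)" "\<And>i. diameter (U i) powr d \<le> w i"
    and D: "\<And>s t. \<lbrakk>s \<in> D; t \<in> D; s \<in> {x..x + h}; t \<in> {x..x + h}\<rbrakk> \<Longrightarrow> \<bar>s - t\<bar> < h / real N"
    and W: "met_weight U w {x..x + h} < (h / real N) powr d"
  shows "\<exists>y. {y..y + h / real N} \<subseteq> {x..x + h} \<and> {y..y + h / real N} \<inter> D = {} \<and>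
     met_weight U w {y..y + h / real N} < (h / real N / real N) powr d"
proof -
  define g where "g = h / real N"
  have g: "g > 0" "x + real N * g = x + h" using h N unfolding g_def by simp_all
  define J where "J j = {x + real j * g..x + real j * g + g}" for j
  let ?I = "{x..x + h}"
  have JI: "J j \<subseteq> ?I" if "j < N" for j
  proof -
    have "(real j + 1) * g \<le> real N * g" using that g(1) by (intro mult_right_mono) auto
    moreover have "0 \<le> real j * g" using g(1) by simp
    ultimately show ?thesis unfolding J_def using g(2) by (auto simp: algebra_simps)
  qed
  have cells_U: "card {j. j < N \<and> J j \<inter> U i \<noteq> {}} \<le> 2" if "U i \<inter> ?I \<noteq> {}" for i
  proof -
    have "diameter (U i) powr d < g powr d"
      using w(4)[of i] le_met_weight[of w U i ?I, OF w(1,2) that] W unfolding g_def by linarith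
    then have "diameter (U i) < g"
      using powr_mono2[of d g "diameter (U i)"] d g(1) by (meson less_imp_le not_le)
    moreover have "\<bar>s - t\<bar> \<le> diameter (U i)" if "s \<in> U i" "t \<in> U i" for s t
      using diameter_bounded_bound[OF w(3) that] by (simp add: dist_real_def)
    ultimately have "\<bar>s - t\<bar> < g" if "s \<in> U i" "t \<in> U i" for s t
      using that by (meson le_less_trans)
    then show ?thesis unfolding J_def by (intro few_cells_met[OF g(1)]) auto
  qed
  have cells_D: "card {j. j < N \<and> J j \<inter> D \<noteq> {}} \<le> 2"
    unfolding J_def
  proof (rule few_cells_met[OF g(1)], unfold g(2))
    show "\<bar>s - t\<bar> < g" if "s \<in> D" "t \<in> D" "s \<in> ?I" "t \<in> ?I" for s t
      using D[OF that] unfolding g_def .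
  qed
  define good where "good = {j. j < N \<and> J j \<inter> D = {}}"
  have "card good = card ({..<N} - {j. j < N \<and> J j \<inter> D \<noteq> {}})"
    unfolding good_def by (rule arg_cong[where f = card]) auto
  also have "\<dots> = N - card {j. j < N \<and> J j \<inter> D \<noteq> {}}"
    by (subst card_Diff_subset) auto
  finally have good: "real N - 2 \<le> real (card good)" using cells_D by linarith
  note sm = summable_met_weight[OF w(1,2), of U]
  have nonneg: "0 \<le> met_weight U w I" for I
    unfolding met_weight_def by (intro suminf_nonneg sm) (simp add: w(2))
  have "(\<Sum>j\<in>good. met_weight U w (J j)) \<le> (\<Sum>j<N. met_weight U w (J j))"
    using nonneg by (intro sum_mono2) (auto simp: good_def)
  also have "\<dots> = (\<Sum>i. \<Sum>j<N. if U i \<inter> J j \<noteq> {} then w i else 0)"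
    unfolding met_weight_def by (rule suminf_sum[symmetric]) (rule sm)
  also have "\<dots> \<le> (\<Sum>i. 2 * (if U i \<inter> ?I \<noteq> {} then w i else 0))"
  proof (rule suminf_le)
    fix i
    show "(\<Sum>j<N. if U i \<inter> J j \<noteq> {} then w i else 0) \<le> 2 * (if U i \<inter> ?I \<noteq> {} then w i else 0)"
    proof (cases "U i \<inter> ?I = {}")
      case True
      then have "U i \<inter> J j = {}" if "j < N" for j using JI[OF that] by blast
      then show ?thesis using True by simp
    next
      case False
      have "(\<Sum>j<N. if U i \<inter> J j \<noteq> {} then w i else 0) = (\<Sum>j\<in>{j. j < N \<and> J j \<inter> U i \<noteq> {}}. w i)"
        by (intro sum.mono_neutral_cong_right) auto
      also have "\<dots> \<le> 2 * w i" using cells_U[OF False] w(2)[of i] by (simp add: mult_right_mono)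
      finally show ?thesis using False by simp
    qed
  qed (intro summable_sum summable_mult sm)+
  also have "\<dots> = 2 * met_weight U w ?I"
    unfolding met_weight_def by (rule suminf_mult) (rule sm)
  also have "\<dots> < 2 * g powr d" using W unfolding g_def by simp
  also have "\<dots> = 2 * real N powr d * (g / real N) powr d" using g(1) N by (simp add: powr_divide)
  also have "\<dots> \<le> real (card good) * (g / real N) powr d"
    using good N by (intro mult_right_mono) auto
  finally have lt: "(\<Sum>j\<in>good. met_weight U w (J j)) < real (card good) * (g / real N) powr d" .
  have "\<exists>j\<in>good. met_weight U w (J j) < (g / real N) powr d"
  proof (rule ccontr)
    assume "\<not> ?thesis"
    then have "(\<Sum>j\<in>good. met_weight U w (J j)) \<ge> (\<Sum>j\<in>good. (g / real N) powr d)"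
      by (intro sum_mono) (auto simp: not_less)
    then show False using lt by simp
  qed
  then obtain j where "j < N" "J j \<inter> D = {}" "met_weight U w (J j) < (g / real N) powr d"
    unfolding good_def by blast
  then show ?thesis using JI[of j] unfolding J_def g_def by blast
qed

text \<open>A lower bound for Hausdorff dimension without a measure on the set: a cover of small total weight misses some
  point of the Cantor set of points that avoid all obstructions. The cells chosen by repeated use of
  \<open>avoidance_step\<close> shrink to a point \<open>z\<close>. If \<open>z\<close> were in \<open>U i\<close>, then \<open>w i\<close> would be part
  of the met weight of every cell, which tends to \<open>0\<close>; this is why all weights have to be
  positive, even for sets of diameter \<open>0\<close>.\<close>

lemma point_avoiding_obstructions_and_cover:
  fixes u \<rho> d :: real and D :: "nat \<Rightarrow> real set"
  assumes \<rho>: "\<rho> > 0" and d: "d > 0" and N: "N > 2" "2 * real N powr d \<le> real N - 2"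
    and w: "summable w" "\<And>i. 0 < w i" "\<And>i. bounded (U i)" "\<And>i. diameter (U i) powr d \<le> w i"
    and D: "\<And>k x s t. \<lbrakk>{x..x + \<rho> / real N ^ k} \<subseteq> {u..u + \<rho>}; s \<in> D k; t \<in> D k;
        s \<in> {x..x + \<rho> / real N ^ k}; t \<in> {x..x + \<rho> / real N ^ k}\<rbrakk> \<Longrightarrow> \<bar>s - t\<bar> < \<rho> / real N ^ Suc k"
    and total: "suminf w < (\<rho> / real N) powr d"
  shows "\<exists>z\<in>{u..u + \<rho>}. (\<forall>k. z \<notin> D k) \<and> (\<forall>i. z \<notin> U i)"
proof -
  define h where "h k = \<rho> / real N ^ k" for k
  have h: "h k > 0" "h k / real N = h (Suc k)" for k using \<rho> N unfolding h_def by (auto simp: field_simps)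
  have w0: "0 \<le> w i" for i using w(2)[of i] by simp
  note D' = D[folded h_def]
  define ok where "ok k x \<longleftrightarrow> {x..x + h k} \<subseteq> {u..u + \<rho>} \<and>
      met_weight U w {x..x + h k} < h (Suc k) powr d" for k x
  define step where "step k x y \<longleftrightarrow> {y..y + h (Suc k)} \<subseteq> {x..x + h k} \<and> {y..y + h (Suc k)} \<inter> D k = {}"
    for k and x y :: real
  have "\<exists>x. ok 0 x"
  proof
    have "met_weight U w {u..u + h 0} \<le> suminf w"
      unfolding met_weight_def using w0 by (intro suminf_le summable_met_weight w(1)) auto
    then show "ok 0 u" using total unfolding ok_def by (simp add: h_def)
  qed
  moreover have "\<exists>y. ok (Suc k) y \<and> step k x y" if "ok k x" for k x
  proof -
    have "\<exists>y. {y..y + h k / real N} \<subseteq> {x..x + h k} \<and> {y..y + h k / real N} \<inter> D k = {} \<and>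
        met_weight U w {y..y + h k / real N} < (h k / real N / real N) powr d"
    proof (rule avoidance_step[OF h(1) d N w(1) w0 w(3,4)])
      show "\<bar>s - t\<bar> < h k / real N"
        if "s \<in> D k" "t \<in> D k" "s \<in> {x..x + h k}" "t \<in> {x..x + h k}" for s t
        unfolding h(2) using D'[OF _ that] \<open>ok k x\<close> unfolding ok_def by blast
      show "met_weight U w {x..x + h k} < (h k / real N) powr d"
        using that unfolding ok_def h(2) by simp
    qed
    then obtain y where "{y..y + h (Suc k)} \<subseteq> {x..x + h k}" "{y..y + h (Suc k)} \<inter> D k = {}"
        "met_weight U w {y..y + h (Suc k)} < h (Suc (Suc k)) powr d"
      unfolding h(2) by blast
    then have "ok (Suc k) y \<and> step k x y" using that unfolding ok_def step_def by (meson order_trans)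
    then show ?thesis by blast
  qed
  ultimately obtain x where x: "\<And>k. ok k (x k)" "\<And>k. step k (x k) (x (Suc k))"
    using dependent_nat_choice[of ok step] by blast
  let ?I = "\<lambda>k. {x k..x k + h k}"
  obtain z where z: "\<And>k. z \<in> ?I k"
  proof (rule bounded_closed_nest[of ?I])
    show "?I n \<subseteq> ?I m" if "m \<le> n" for m n
      using that by (rule lift_Suc_antimono_le[rotated]) (use x(2) in \<open>auto simp: step_def\<close>)
    show "?I n \<noteq> {}" for n using h(1)[of n] by simp
  qed auto
  have "z \<notin> U i" for i
  proof
    assume "z \<in> U i"
    have lt: "w i < h (Suc k) powr d" for k
    proof -
      have "U i \<inter> ?I k \<noteq> {}" using z[of k] \<open>z \<in> U i\<close> by blast
      from le_met_weight[of w U i "?I k", OF w(1) w0 this] show ?thesis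
        using x(1)[of k] unfolding ok_def by linarith
    qed
    have "(\<lambda>k. \<rho> / real N ^ k) \<longlonglongrightarrow> 0" using N by (intro LIMSEQ_divide_realpow_zero) simp
    then have "(\<lambda>k. h (Suc k)) \<longlonglongrightarrow> 0" unfolding h_def by (rule LIMSEQ_Suc)
    moreover have "w i powr (1 / d) > 0" using w(2)[of i] by simp
    ultimately have "\<forall>\<^sub>F k in sequentially. h (Suc k) < w i powr (1 / d)" by (rule order_tendstoD)
    then obtain k where "h (Suc k) < w i powr (1 / d)"
      using eventually_happens trivial_limit_sequentially by blast
    then have "h (Suc k) powr d < (w i powr (1 / d)) powr d"
      using h(1)[of "Suc k"] d by (intro powr_less_mono2) auto
    then show False using lt[of k] w(2)[of i] d by (simp add: powr_powr)
  qed
  moreover have "z \<notin> D k" for k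
    using z[of "Suc k"] x(2)[of k] unfolding step_def by blast
  moreover have "z \<in> {u..u + \<rho>}" using z[of 0] x(1)[of 0] unfolding ok_def by blast
  ultimately show ?thesis by blast
qed

section \<open>Parameters of a curve close to rational points\<close>

definition locally_bilipschitz :: "real \<Rightarrow> real \<Rightarrow> real \<Rightarrow> real set \<Rightarrow> (real \<Rightarrow> 'a::real_normed_vector) \<Rightarrow> bool" where
  "locally_bilipschitz \<delta> c L B \<phi> \<longleftrightarrow> 0 < \<delta> \<and> 0 < c \<and> 0 < L \<and>
     (\<forall>s\<in>B. \<forall>t\<in>B. \<bar>s - t\<bar> \<le> \<delta> \<longrightarrow>
        c * \<bar>s - t\<bar> \<le> norm (\<phi> s - \<phi> t) \<and> norm (\<phi> s - \<phi> t) \<le> L * \<bar>s - t\<bar>)"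

text \<open>By uniform continuity, \<open>\<phi>'\<close> varies on short intervals by less than half of the minimum of its norm, so that
  \<open>\<phi>\<close> is there a small perturbation of an affine map with non-zero slope.\<close>

lemma C1_imp_locally_bilipschitz:
  fixes \<phi> :: "real \<Rightarrow> 'a::real_normed_vector"
  assumes ab: "\<alpha> < \<beta>" and C1: "C1_holder_on \<epsilon> {\<alpha>..\<beta>} \<phi>"
    and nz: "\<forall>s\<in>{\<alpha>..\<beta>}. vector_derivative \<phi> (at s within {\<alpha>..\<beta>}) \<noteq> 0"
  obtains \<delta> c L where "locally_bilipschitz \<delta> c L {\<alpha>..\<beta>} \<phi>"
proof -
  let ?B = "{\<alpha>..\<beta>}"
  define \<phi>' where "\<phi>' s = vector_derivative \<phi> (at s within ?B)" for s
  have deriv: "(\<phi> has_vector_derivative \<phi>' s) (at s within ?B)" if "s \<in> ?B" for s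
    using C1 that unfolding C1_holder_on_def \<phi>'_def differentiable_on_def
    by (simp add: vector_derivative_works[symmetric])
  have cont: "continuous_on ?B \<phi>'" using C1 unfolding C1_holder_on_def \<phi>'_def by simp
  have contn: "continuous_on ?B (\<lambda>s. norm (\<phi>' s))" using cont by (rule continuous_on_norm)
  obtain s0 where s0: "s0 \<in> ?B" "\<And>s. s \<in> ?B \<Longrightarrow> norm (\<phi>' s0) \<le> norm (\<phi>' s)"
    using continuous_attains_inf[OF compact_Icc _ contn] ab by auto
  obtain s1 where s1: "s1 \<in> ?B" "\<And>s. s \<in> ?B \<Longrightarrow> norm (\<phi>' s) \<le> norm (\<phi>' s1)"
    using continuous_attains_sup[OF compact_Icc _ contn] ab by auto
  define m where "m = norm (\<phi>' s0)"
  define M where "M = norm (\<phi>' s1)"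
  have m: "m > 0" using nz s0(1) unfolding m_def \<phi>'_def by simp
  have "uniformly_continuous_on ?B \<phi>'" using cont by (rule compact_uniformly_continuous) simp
  then obtain d where d: "d > 0" "\<And>s t. \<lbrakk>s \<in> ?B; t \<in> ?B; dist t s < d\<rbrakk> \<Longrightarrow> dist (\<phi>' t) (\<phi>' s) < m / 2"
    using m unfolding uniformly_continuous_on_def by (meson half_gt_zero)
  have lin: "norm (\<phi> t - \<phi> s - (t - s) *\<^sub>R \<phi>' s) \<le> norm (t - s) * (m / 2)"
    if st: "s \<in> ?B" "t \<in> ?B" "\<bar>s - t\<bar> \<le> d / 2" for s t
  proof (rule vector_differentiable_bound_linearization)
    have sub: "closed_segment s t \<subseteq> ?B" using st by (simp add: closed_segment_subset)
    show "(\<phi> has_vector_derivative \<phi>' x) (at x within closed_segment s t)" if "x \<in> closed_segment s t" for x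
      using deriv sub that by (meson has_vector_derivative_within_subset subsetD)
    show "norm (\<phi>' x - \<phi>' s) \<le> m / 2" if "x \<in> closed_segment s t" for x
    proof -
      have "\<bar>x - s\<bar> \<le> \<bar>s - t\<bar>" using that by (auto simp: closed_segment_eq_real_ivl split: if_splits)
      then have "dist x s < d" using st(3) d(1) by (simp add: dist_real_def)
      then have "dist (\<phi>' x) (\<phi>' s) < m / 2" using d(2)[of s x] sub that st(1) by blast
      then show ?thesis by (simp add: dist_norm)
    qed
  qed auto
  have "locally_bilipschitz (d / 2) (m / 2) (M + m / 2) ?B \<phi>"
    unfolding locally_bilipschitz_def
  proof (intro conjI ballI impI)
    fix s t assume st: "s \<in> ?B" "t \<in> ?B" "\<bar>s - t\<bar> \<le> d / 2"
    let ?e = "\<phi> t - \<phi> s - (t - s) *\<^sub>R \<phi>' s"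
    have e: "norm ?e \<le> \<bar>s - t\<bar> * (m / 2)" using lin[OF st] by (simp add: abs_minus_commute)
    have split: "\<phi> t - \<phi> s = (t - s) *\<^sub>R \<phi>' s + ?e" by simp
    have n: "norm ((t - s) *\<^sub>R \<phi>' s) = \<bar>s - t\<bar> * norm (\<phi>' s)" by (simp add: abs_minus_commute)
    have "\<bar>s - t\<bar> * m \<le> \<bar>s - t\<bar> * norm (\<phi>' s)" "\<bar>s - t\<bar> * norm (\<phi>' s) \<le> \<bar>s - t\<bar> * M"
      using s0(2)[OF st(1)] s1(2)[OF st(1)] unfolding m_def M_def by (intro mult_left_mono; simp)+
    moreover have "norm (\<phi> t - \<phi> s) \<le> \<bar>s - t\<bar> * norm (\<phi>' s) + norm ?e"
      using norm_triangle_ineq[of "(t - s) *\<^sub>R \<phi>' s" ?e] unfolding split[symmetric] n .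
    moreover have "\<bar>s - t\<bar> * norm (\<phi>' s) - norm ?e \<le> norm (\<phi> t - \<phi> s)"
      using norm_diff_ineq[of "(t - s) *\<^sub>R \<phi>' s" ?e] unfolding split[symmetric] n .
    ultimately show "m / 2 * \<bar>s - t\<bar> \<le> norm (\<phi> s - \<phi> t)" "norm (\<phi> s - \<phi> t) \<le> (M + m / 2) * \<bar>s - t\<bar>"
      using e by (simp_all add: norm_minus_commute algebra_simps)
  next
    have "M \<ge> 0" unfolding M_def by simp
    then show "0 < M + m / 2" using m by simp
  qed (use d(1) m in auto)
  then show thesis by (rule that)
qed

text \<open>Distinct points of a fibre are more than \<open>\<delta>\<close> apart.\<close>

lemma locally_bilipschitz_fibre_countable:
  assumes bl: "locally_bilipschitz \<delta> c L {\<alpha>..\<beta>} \<phi>"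
  shows "countable {s \<in> {\<alpha>..\<beta>}. \<phi> s = y}"
proof -
  have \<delta>: "\<delta> > 0" using bl by (simp add: locally_bilipschitz_def)
  have inj: "inj_on (\<lambda>s. \<lfloor>s / \<delta>\<rfloor>) {s \<in> {\<alpha>..\<beta>}. \<phi> s = y}"
  proof (rule inj_onI)
    fix s t assume st: "s \<in> {s \<in> {\<alpha>..\<beta>}. \<phi> s = y}" "t \<in> {s \<in> {\<alpha>..\<beta>}. \<phi> s = y}" "\<lfloor>s / \<delta>\<rfloor> = \<lfloor>t / \<delta>\<rfloor>"
    then have "\<bar>s / \<delta> - t / \<delta>\<bar> \<le> 1" by linarith
    then have "\<bar>s - t\<bar> \<le> \<delta>" using \<delta> by (simp add: field_simps abs_le_iff)
    then have "c * \<bar>s - t\<bar> \<le> 0" "c > 0"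
      using bl st unfolding locally_bilipschitz_def by fastforce+
    then show "s = t" by (simp add: mult_le_0_iff)
  qed
  show ?thesis by (rule countable_image_inj_on[OF _ inj]) (rule countableI_type)
qed

text \<open>The lower end of the window is \<open>R\<close> times smaller than the upper one, so that windows at scales
  \<open>r\<close> and \<open>r / R\<close> are adjacent. The radius \<open>\<epsilon> / q\<close> is that of bad approximability.\<close>

definition danger :: "(real \<Rightarrow> real ^ 'm) \<Rightarrow> real \<Rightarrow> real \<Rightarrow> real \<Rightarrow> real \<Rightarrow> real set" where
  "danger \<phi> L R \<epsilon> r = {s. \<exists>(p :: int ^ 'm) q. 0 < q \<and> rat_point p q \<in> (sphere 0 1 :: (real ^ 'm) set) \<and>
     1 / (2 * L * R * r) \<le> real q \<and> real q < 1 / (2 * L * r) \<and>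
     norm (\<phi> s - rat_point p q) < \<epsilon> / real q}"

text \<open>The window of heights is chosen such that an interval of length \<open>r\<close> sees at most one rational point: two
  of them would be at distance at most \<open>3/2 L r\<close>, but distinct points of heights below
  \<open>1 / (2 L r)\<close> are at least \<open>2 L r\<close> apart. The parameters close to a single rational point form a short cluster.\<close>

lemma danger_clusters:
  fixes \<phi> :: "real \<Rightarrow> real ^ 'm"
  assumes bl: "locally_bilipschitz \<delta> c L B \<phi>" and st: "s \<in> B" "t \<in> B" "\<bar>s - t\<bar> \<le> r" "0 < r" "r \<le> \<delta>"
    and dg: "s \<in> danger \<phi> L R \<epsilon> r" "t \<in> danger \<phi> L R \<epsilon> r"
    and R: "R > 0" "\<epsilon> > 0" "\<epsilon> * R \<le> 1 / 8"
  shows "\<bar>s - t\<bar> \<le> 4 * L * \<epsilon> * R / c * r"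
proof -
  have L: "L > 0" "c > 0" using bl by (simp_all add: locally_bilipschitz_def)
  have bls: "c * \<bar>s - t\<bar> \<le> norm (\<phi> s - \<phi> t)" "norm (\<phi> s - \<phi> t) \<le> L * \<bar>s - t\<bar>"
    using bl st unfolding locally_bilipschitz_def by auto
  obtain p q where pq: "0 < q" "rat_point p q \<in> (sphere 0 1 :: (real ^ 'm) set)"
     "1 / (2 * L * R * r) \<le> real q" "real q < 1 / (2 * L * r)" "norm (\<phi> s - rat_point p q) < \<epsilon> / real q"
    using dg(1) unfolding danger_def by blast
  obtain p' q' where pq': "0 < q'" "rat_point p' q' \<in> (sphere 0 1 :: (real ^ 'm) set)"
     "1 / (2 * L * R * r) \<le> real q'" "real q' < 1 / (2 * L * r)" "norm (\<phi> t - rat_point p' q') < \<epsilon> / real q'"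
    using dg(2) unfolding danger_def by blast
  let ?P = "rat_point p q :: real ^ 'm" and ?P' = "rat_point p' q' :: real ^ 'm"
  have rad: "\<epsilon> / real n \<le> 2 * \<epsilon> * L * R * r" if "1 / (2 * L * R * r) \<le> real n" "0 < n" for n :: nat
    using that L R st(4) by (simp add: field_simps)
  have near: "norm (\<phi> s - ?P) \<le> 2 * \<epsilon> * L * R * r" "norm (\<phi> t - ?P') \<le> 2 * \<epsilon> * L * R * r"
    using pq(5) pq'(5) rad[OF pq(3,1)] rad[OF pq'(3,1)] by linarith+
  have "L * r * (\<epsilon> * R) \<le> L * r * (1 / 8)" using L st(4) R by (intro mult_left_mono) auto
  then have "2 * \<epsilon> * L * R * r \<le> L * r / 4" by (simp add: algebra_simps)
  moreover have "norm (\<phi> s - \<phi> t) \<le> L * r"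
    using bls(2) mult_left_mono[OF st(3), of L] L by linarith
  moreover have "?P - ?P' = (\<phi> s - \<phi> t) - (\<phi> s - ?P) + (\<phi> t - ?P')" by simp
  then have "norm (?P - ?P') \<le> norm (\<phi> s - \<phi> t) + norm (\<phi> s - ?P) + norm (\<phi> t - ?P')"
    by (smt (verit) norm_triangle_ineq norm_triangle_ineq4)
  ultimately have "norm (?P - ?P') \<le> L * r + L * r / 4 + L * r / 4" using near by linarith
  moreover have "0 < L * r" using L st(4) by simp
  ultimately have "norm (?P - ?P') \<le> 1 / (1 / (2 * L * r))" by simp
  then have eq: "?P = ?P'"
    using pq pq' by (intro rat_point_eqI[where H = "1 / (2 * L * r)"]) auto
  have "\<phi> s - \<phi> t = (\<phi> s - ?P) - (\<phi> t - ?P')" unfolding eq by simp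
  then have "norm (\<phi> s - \<phi> t) \<le> norm (\<phi> s - ?P) + norm (\<phi> t - ?P')" by (metis norm_triangle_ineq4)
  then have "c * \<bar>s - t\<bar> \<le> 4 * L * \<epsilon> * R * r" using near bls(1) by (simp add: mult_ac)
  then show ?thesis using L by (simp add: field_simps)
qed

text \<open>At the scales \<open>\<rho> / R ^ k\<close> the windows of heights are adjacent, so together they contain every
  large height.\<close>

lemma avoiding_danger_imp_badly_approximable:
  fixes \<phi> :: "real \<Rightarrow> real ^ 'm"
  assumes s: "\<phi> s \<in> sphere 0 1" and pos: "L > 0" "R > 1" "\<epsilon> > 0" "\<rho> > 0"
    and safe: "\<And>k. k \<ge> K \<Longrightarrow> s \<notin> danger \<phi> L R \<epsilon> (\<rho> / R ^ k)"
  shows "badly_approximable (\<phi> s)"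
proof (rule ccontr)
  assume "\<not> ?thesis"
  then have app: "\<phi> s \<in> approximable (\<lambda>q. \<epsilon> * phi 1 q)" using s pos unfolding badly_approximable_def by blast
  define H where "H k = R ^ k / (2 * L * \<rho>)" for k
  obtain Q where Q: "H K \<le> real Q" using real_arch_simple by blast
  obtain p q where pq: "Q < q" "rat_point p q \<in> (sphere 0 1 :: (real ^ 'm) set)"
      "norm (\<phi> s - rat_point p q) < \<epsilon> * phi 1 q"
    using approximable_large_height[OF app, of Q] by blast
  have q0: "0 < q" using pq(1) by simp
  obtain k1 where "real q * (2 * L * \<rho>) < R ^ k1" using real_arch_pow[OF pos(2)] by blast
  then have k1: "real q < H k1" unfolding H_def using pos by (simp add: field_simps)
  define k where "k = (LEAST k. real q < H k)"
  have k: "real q < H k" unfolding k_def using k1 by (rule LeastI)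
  have mono: "H i \<le> H j" if "i \<le> j" for i j
    unfolding H_def using that pos by (intro divide_right_mono power_increasing) auto
  have "K < k"
  proof (rule ccontr)
    assume "\<not> K < k"
    then have "H k \<le> H K" by (intro mono) simp
    then show False using k Q pq(1) by linarith
  qed
  then obtain j where j: "k = Suc j" "K \<le> j" by (cases k) auto
  have "\<not> real q < H j" using not_less_Least[of j "\<lambda>k. real q < H k"] j unfolding k_def by simp
  then have "1 / (2 * L * R * (\<rho> / R ^ Suc j)) \<le> real q" "real q < 1 / (2 * L * (\<rho> / R ^ Suc j))"
    using k pos unfolding j H_def by (simp_all add: field_simps)
  moreover have "norm (\<phi> s - rat_point p q) < \<epsilon> / real q"
    using pq(3) q0 by (simp add: phi_def powr_minus_divide)
  ultimately have "s \<in> danger \<phi> L R \<epsilon> (\<rho> / R ^ Suc j)"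
    unfolding danger_def using pq(2) q0 by blast
  then show False using safe[of "Suc j"] j by simp
qed

section \<open>Singular on average parameters\<close>

lemma hausdorff_dim_singular_on_average:
  fixes \<phi> :: "real \<Rightarrow> real ^ 'm"
  assumes bl: "locally_bilipschitz \<delta> c L {\<alpha>..\<beta>} \<phi>"
  shows "hausdorff_dim {s \<in> {\<alpha>..\<beta>}. singular_on_average (\<phi> s)} \<le> ennreal (1 / 2)"
proof -
  have "countable (range (\<lambda>(p :: int ^ 'm, q). rat_point p q))" by simp
  then have "countable (\<Union>y\<in>range (\<lambda>(p :: int ^ 'm, q). rat_point p q). {s \<in> {\<alpha>..\<beta>}. \<phi> s = y})"
    by (intro countable_UN locally_bilipschitz_fibre_countable[OF bl])
  moreover have "{s \<in> {\<alpha>..\<beta>}. singular_on_average (\<phi> s)} \<subseteq>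
      (\<Union>y\<in>range (\<lambda>(p :: int ^ 'm, q). rat_point p q). {s \<in> {\<alpha>..\<beta>}. \<phi> s = y})"
    using singular_on_average_imp_rational by fastforce
  ultimately have "countable {s \<in> {\<alpha>..\<beta>}. singular_on_average (\<phi> s)}"
    by (rule countable_subset[rotated])
  then show ?thesis by (intro hausdorff_dim_le hausdorff_measure_countable) auto
qed

section \<open>Thickness of the badly approximable parameters\<close>

text \<open>The danger zones at the scales \<open>\<rho> / N ^ k\<close> are obstructions in the sense of
  \<open>point_avoiding_obstructions_and_cover\<close>, and \<open>N\<close> can be taken as large as an exponent \<open>d < 1\<close>
  requires.\<close>

lemma hausdorff_dim_badly_approximable_ge_1:
  fixes \<phi> :: "real \<Rightarrow> real ^ 'm"
  assumes bl: "locally_bilipschitz \<delta> c L B \<phi>" and sph: "\<phi> ` B \<subseteq> sphere 0 1"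
    and uv: "u < v" "{u..v} \<subseteq> B" and S: "{s \<in> {u..v}. badly_approximable (\<phi> s)} \<subseteq> S"
  shows "1 \<le> hausdorff_dim S"
proof -
  have pos: "\<delta> > 0" "c > 0" "L > 0" using bl by (simp_all add: locally_bilipschitz_def)
  have "1 \<le> d" if d: "0 \<le> d" "hausdorff_measure d S = 0" for d
  proof (rule ccontr)
    assume "\<not> 1 \<le> d"
    \<comment> \<open>An exponent strictly between, which is positive even for \<open>d = 0\<close>.\<close>
    define e where "e = (1 + d) / 2"
    have e: "0 < e" "e < 1" "d \<le> e" using d(1) \<open>\<not> 1 \<le> d\<close> unfolding e_def by auto
    \<comment> \<open>This gives \<open>2 N\<^sup>e \<le> N / 2 \<le> N - 2\<close>.\<close>
    obtain N :: nat where N: "real N \<ge> max 4 (4 powr (1 / (1 - e)))" using real_arch_simple by blast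
    have N2: "N > 2" using N by simp
    have "4 = (4 powr (1 / (1 - e))) powr (1 - e)" using e by (simp add: powr_powr)
    also have "\<dots> \<le> real N powr (1 - e)" using N e by (intro powr_mono2) auto
    also have "\<dots> = real N / real N powr e" using N2 by (simp add: powr_diff)
    finally have "4 * real N powr e \<le> real N" using N2 by (simp add: field_simps)
    then have Ne: "2 * real N powr e \<le> real N - 2" using N by simp
    define \<rho> where "\<rho> = min \<delta> (v - u)"
    have \<rho>: "\<rho> > 0" "\<rho> \<le> \<delta>" "u + \<rho> \<le> v" using pos uv unfolding \<rho>_def by auto
    \<comment> \<open>The clusters must be shorter than one of the \<open>N\<close> cells.\<close>
    define \<epsilon> where "\<epsilon> = min (1 / (8 * real N)) (c / (8 * L * (real N)\<^sup>2))"
    have \<epsilon>: "\<epsilon> > 0" using pos N2 unfolding \<epsilon>_def by simp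
    have \<epsilon>1: "\<epsilon> * real N \<le> 1 / 8"
    proof -
      have "\<epsilon> * real N \<le> 1 / (8 * real N) * real N" unfolding \<epsilon>_def by (intro mult_right_mono) auto
      then show ?thesis using N2 by simp
    qed
    have \<epsilon>2: "4 * L * \<epsilon> * real N / c < 1 / real N"
    proof -
      have "\<epsilon> * (8 * L * (real N)\<^sup>2 / c) \<le> c / (8 * L * (real N)\<^sup>2) * (8 * L * (real N)\<^sup>2 / c)"
        unfolding \<epsilon>_def using pos by (intro mult_right_mono) auto
      also have "\<dots> = 1" using pos N2 by simp
      finally have "2 * (real N * (4 * L * \<epsilon> * real N / c)) \<le> 1" by (simp add: power2_eq_square mult_ac)
      then have "real N * (4 * L * \<epsilon> * real N / c) < 1" by linarith
      then show ?thesis using N2 by (simp add: field_simps)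
    qed
    define \<eta> where "\<eta> = (\<rho> / real N) powr e / 2"
    have \<eta>: "\<eta> > 0" using \<rho> N2 unfolding \<eta>_def by simp
    obtain U where U: "S \<subseteq> (\<Union>i. U i)" "\<And>i. bounded (U i)"
        "summable (\<lambda>i. diameter (U i) powr e)" "(\<Sum>i. diameter (U i) powr e) < \<eta>"
      using hausdorff_null_imp_cover[OF d(2,1) e(3,1) \<eta>] by blast
    \<comment> \<open>The geometric series makes all weights positive at a total cost of \<open>\<eta>\<close>.\<close>
    define w where "w i = diameter (U i) powr e + \<eta> * (1 / 2) ^ Suc i" for i
    have half: "(\<lambda>i. \<eta> * (1 / 2) ^ Suc i) sums (\<eta> * 1)" by (intro sums_mult power_half_series)
    have "w sums ((\<Sum>i. diameter (U i) powr e) + \<eta> * 1)"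
      unfolding w_def by (intro sums_add summable_sums U(3) half)
    then have w: "summable w" "suminf w < 2 * \<eta>" using U(4) by (auto simp: sums_iff)
    define D where "D k = danger \<phi> L (real N) \<epsilon> (\<rho> / real N ^ k)" for k
    have "\<exists>z\<in>{u..u + \<rho>}. (\<forall>k. z \<notin> D k) \<and> (\<forall>i. z \<notin> U i)"
    proof (rule point_avoiding_obstructions_and_cover[OF \<rho>(1) e(1) N2 Ne w(1) _ U(2)])
      show "0 < w i" "diameter (U i) powr e \<le> w i" for i
        using \<eta> unfolding w_def by (auto intro: add_nonneg_pos)
      show "suminf w < (\<rho> / real N) powr e" using w(2) unfolding \<eta>_def by simp
      fix k x s t
      let ?r = "\<rho> / real N ^ k"
      assume sub: "{x..x + ?r} \<subseteq> {u..u + \<rho>}" and dg: "s \<in> D k" "t \<in> D k"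
        and st: "s \<in> {x..x + ?r}" "t \<in> {x..x + ?r}"
      have r: "0 < ?r" "?r \<le> \<delta>"
      proof -
        show "0 < ?r" using \<rho> N2 by simp
        have "\<rho> / real N ^ k \<le> \<rho> / 1" using \<rho> N2 by (intro divide_left_mono) auto
        then show "?r \<le> \<delta>" using \<rho> by simp
      qed
      have B: "s \<in> B" "t \<in> B" using sub st uv \<rho>(3) by (auto simp: subset_iff)
      have "\<bar>s - t\<bar> \<le> ?r" using st by auto
      then have "\<bar>s - t\<bar> \<le> 4 * L * \<epsilon> * real N / c * ?r"
        using danger_clusters[OF bl B _ r, of "real N" \<epsilon>] dg \<epsilon> \<epsilon>1 N2 unfolding D_def by simp
      also have "\<dots> < 1 / real N * ?r" by (rule mult_strict_right_mono[OF \<epsilon>2 r(1)])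
      finally show "\<bar>s - t\<bar> < \<rho> / real N ^ Suc k" by (simp add: mult_ac)
    qed
    then obtain z where z: "z \<in> {u..u + \<rho>}" "\<And>k. z \<notin> D k" "\<And>i. z \<notin> U i" by blast
    have zuv: "z \<in> {u..v}" using z(1) \<rho>(3) by auto
    then have "\<phi> z \<in> sphere 0 1" using sph uv by blast
    then have "badly_approximable (\<phi> z)"
      by (rule avoiding_danger_imp_badly_approximable[where R = "real N" and K = 0 and L = L and \<epsilon> = \<epsilon> and \<rho> = \<rho>])
         (use pos N2 \<epsilon> \<rho> z(2) in \<open>auto simp: D_def\<close>)
    then have "z \<in> S" using S zuv by blast
    then show False using U(1) z(3) by blast
  qed
  then show ?thesis unfolding hausdorff_dim_def by (auto intro!: Inf_greatest simp: ennreal_ge_1)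
qed

lemma relatively_open_contains_interval:
  fixes \<alpha> \<beta> :: real
  assumes "\<alpha> < \<beta>" "openin (top_of_set {\<alpha>..\<beta>}) U" "U \<noteq> {}"
  obtains u v where "u < v" "{u..v} \<subseteq> U"
proof -
  obtain x where x: "x \<in> U" using assms(3) by blast
  obtain e where e: "e > 0" "ball x e \<inter> {\<alpha>..\<beta>} \<subseteq> U"
    using assms(2) x unfolding openin_contains_ball by blast
  have "x \<in> {\<alpha>..\<beta>}" using assms(2) x openin_imp_subset by blast
  then have "{max \<alpha> (x - e / 2)..min \<beta> (x + e / 2)} \<subseteq> ball x e \<inter> {\<alpha>..\<beta>}"
      and "max \<alpha> (x - e / 2) < min \<beta> (x + e / 2)"
    using e(1) assms(1) by (auto simp: dist_real_def)
  then show thesis using that e(2) by blast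
qed

section \<open>The Schmidt game\<close>

lemma legal_move_interval:
  assumes "legal_move \<sigma> t {x..x + r} D" "0 < r"
  shows "\<exists>y. D = {y..y + exp (- \<sigma> * t) * r} \<and> {y..y + exp (- \<sigma> * t) * r} \<subseteq> {x..x + r}"
proof -
  obtain y where y: "D = (\<lambda>z. exp (- \<sigma> * t) * z + y) ` {x..x + r}" "D \<subseteq> {x..x + r}"
    using assms(1) unfolding legal_move_def by blast
  have "D = {exp (- \<sigma> * t) * x + y..exp (- \<sigma> * t) * (x + r) + y}"
    unfolding y(1) image_affinity_atLeastAtMost using assms(2) by simp
  then have "D = {exp (- \<sigma> * t) * x + y..exp (- \<sigma> * t) * x + y + exp (- \<sigma> * t) * r}"
    by (simp add: algebra_simps)
  then show ?thesis using y(2) by metis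
qed

lemma legal_move_intervalI:
  assumes "0 \<le> r" "{y..y + exp (- \<sigma> * t) * r} \<subseteq> {x..x + r}"
  shows "legal_move \<sigma> t {x..x + r} {y..y + exp (- \<sigma> * t) * r}"
proof -
  have "{y..y + exp (- \<sigma> * t) * r} = (\<lambda>z. exp (- \<sigma> * t) * z + (y - exp (- \<sigma> * t) * x)) ` {x..x + r}"
    unfolding image_affinity_atLeastAtMost using assms(1) by (simp add: algebra_simps)
  then show ?thesis using assms(2) unfolding legal_move_def by blast
qed

text \<open>A positional strategy: only Bob's last move matters. The obstruction \<open>D\<close> depends on Bob's interval because the
  heights that have to be avoided depend on its length.\<close>

definition evade :: "(real set \<Rightarrow> real set) \<Rightarrow> real set list \<Rightarrow> real set" where
  "evade D Bs = (let C = last Bs; x = Inf C; r = Sup C - Inf C in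
     if {x..x + r / 4} \<inter> D C = {} then {x..x + r / 4} else {x + 3 * r / 4..x + r})"

lemma alice_evade:
  assumes "B k = {x..x + r}" "0 < r"
  shows "alice (evade D) B k =
    (if {x..x + r / 4} \<inter> D (B k) = {} then {x..x + r / 4} else {x + 3 * r / 4..x + r})"
proof -
  have "last (map B [0..<Suc k]) = {x..x + r}" "Inf {x..x + r} = x" "Sup {x..x + r} = x + r"
    using assms by simp_all
  then show ?thesis unfolding alice_def evade_def Let_def using assms(1) by simp
qed

text \<open>Alice shrinks by \<open>1/4\<close> and Bob by \<open>e\<^sup>-\<^sup>\<sigma>\<^sup>b\<close>, so the lengths of Bob's intervals are \<open>\<rho> / R ^ k\<close> with
  \<open>R = 4 e\<^sup>\<sigma>\<^sup>b\<close>, and one round of the game passes one window of heights. As soon as these lengths are below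
  \<open>\<delta>\<close>, the danger zone in Bob's interval has diameter at most a quarter of its length, so it cannot
  meet both outer quarters. The constant \<open>\<epsilon>\<close> depends on \<open>b\<close>, but the contraction \<open>1/4\<close> does not.\<close>

lemma schmidt_winning_badly_approximable:
  fixes \<phi> :: "real \<Rightarrow> real ^ 'm"
  assumes bl: "locally_bilipschitz \<delta> c L {\<alpha>..\<beta>} \<phi>" and sph: "\<phi> ` {\<alpha>..\<beta>} \<subseteq> sphere 0 1"
    and ab: "\<alpha> < \<beta>" and \<sigma>: "\<sigma> > 0"
  shows "schmidt_winning \<sigma> {\<alpha>..\<beta>} {s \<in> {\<alpha>..\<beta>}. badly_approximable (\<phi> s)}"
proof -
  have pos: "\<delta> > 0" "c > 0" "L > 0" using bl by (simp_all add: locally_bilipschitz_def)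
  define a where "a = ln 4 / \<sigma>"
  have a: "a > 0" "exp (- \<sigma> * a) = 1 / 4" using \<sigma> unfolding a_def by (simp_all add: exp_minus)
  have "ab_winning \<sigma> {\<alpha>..\<beta>} a b {s \<in> {\<alpha>..\<beta>}. badly_approximable (\<phi> s)}" if b: "b > 0" for b
  proof -
    define R where "R = 4 * exp (\<sigma> * b)"
    have R: "R > 1" "exp (- \<sigma> * b) * (r / 4) = r / R" for r
      using \<sigma> b by (auto simp: R_def exp_minus field_simps intro: less_trans[of 1 4])
    \<comment> \<open>The clusters must be at most a quarter as long as Bob's interval.\<close>
    define \<epsilon> where "\<epsilon> = min (1 / (8 * R)) (c / (16 * L * R))"
    have \<epsilon>: "\<epsilon> > 0" "\<epsilon> * R \<le> 1 / 8" "4 * L * \<epsilon> * R / c \<le> 1 / 4"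
    proof -
      show "\<epsilon> > 0" using pos R unfolding \<epsilon>_def by simp
      have "\<epsilon> * R \<le> 1 / (8 * R) * R" unfolding \<epsilon>_def using R by (intro mult_right_mono) auto
      then show "\<epsilon> * R \<le> 1 / 8" using R by simp
      have "\<epsilon> * (4 * L * R / c) \<le> c / (16 * L * R) * (4 * L * R / c)"
        unfolding \<epsilon>_def using pos R by (intro mult_right_mono) auto
      also have "\<dots> = 1 / 4" using pos R by (simp add: field_simps)
      finally show "4 * L * \<epsilon> * R / c \<le> 1 / 4" by (simp add: mult_ac)
    qed
    define D where "D C = danger \<phi> L R \<epsilon> (Sup C - Inf C)" for C :: "real set"
    let ?f = "evade D"
    have alice_cases: "\<exists>y. alice ?f B k = {y..y + r / 4} \<and> {y..y + r / 4} \<subseteq> {x..x + r}"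
      if "B k = {x..x + r}" "0 < r" for B k x r
    proof (cases "{x..x + r / 4} \<inter> D (B k) = {}")
      case True
      then show ?thesis using that unfolding alice_evade[where B = B and k = k, OF that] by (intro exI[of _ x]) auto
    next
      case False
      then show ?thesis using that unfolding alice_evade[where B = B and k = k, OF that] by (intro exI[of _ "x + 3 * r / 4"]) auto
    qed
    have bob: "\<exists>x. B n = {x..x + exp (- \<sigma> * t) * (\<beta> - \<alpha>) / R ^ n} \<and> B n \<subseteq> {\<alpha>..\<beta>}"
      if t: "legal_move \<sigma> t {\<alpha>..\<beta>} (B 0)" and bob: "bob_legal_upto \<sigma> b {\<alpha>..\<beta>} ?f B n" for B n t
      using bob
    proof (induction n)
      case 0
      have "legal_move \<sigma> t {\<alpha>..\<alpha> + (\<beta> - \<alpha>)} (B 0)" using t by simp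
      then show ?case using legal_move_interval[of \<sigma> t \<alpha> "\<beta> - \<alpha>" "B 0"] ab by auto
    next
      case (Suc n)
      let ?r = "exp (- \<sigma> * t) * (\<beta> - \<alpha>) / R ^ n"
      have r: "0 < ?r" using ab R by simp
      have "bob_legal_upto \<sigma> b {\<alpha>..\<beta>} ?f B n" using Suc.prems unfolding bob_legal_upto_def by auto
      then obtain x where x: "B n = {x..x + ?r}" "B n \<subseteq> {\<alpha>..\<beta>}" using Suc.IH by blast
      obtain y where y: "alice ?f B n = {y..y + ?r / 4}" "{y..y + ?r / 4} \<subseteq> {x..x + ?r}"
        using alice_cases[where B = B and k = n, OF x(1) r] by blast
      have "legal_move \<sigma> b {y..y + ?r / 4} (B (Suc n))"
        using Suc.prems unfolding bob_legal_upto_def y(1)[symmetric] by blast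
      then obtain z where "B (Suc n) = {z..z + exp (- \<sigma> * b) * (?r / 4)}"
          "{z..z + exp (- \<sigma> * b) * (?r / 4)} \<subseteq> {y..y + ?r / 4}"
        using legal_move_interval r by (metis divide_pos_pos zero_less_numeral)
      then show ?case using x y unfolding R(2) by (intro exI[of _ z]) (auto simp: mult.commute)
    qed
    have "legal_move \<sigma> a (B n) (alice ?f B n)" if leg: "bob_legal_upto \<sigma> b {\<alpha>..\<beta>} ?f B n" for B n
    proof -
      obtain t where "legal_move \<sigma> t {\<alpha>..\<beta>} (B 0)" using leg unfolding bob_legal_upto_def by blast
      moreover have "0 < exp (- \<sigma> * t) * (\<beta> - \<alpha>) / R ^ n" for t using ab R by simp
      ultimately obtain x r where x: "B n = {x..x + r}" "0 < r"
        using bob[where B = B and n = n, OF _ leg] by blast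
      obtain y where y: "alice ?f B n = {y..y + r / 4}" "{y..y + r / 4} \<subseteq> {x..x + r}"
        using alice_cases[where B = B and k = n, OF x] by blast
      then show ?thesis using legal_move_intervalI[of r y \<sigma> a x] x unfolding a(2) by simp
    qed
    moreover have "\<exists>x\<in>{s \<in> {\<alpha>..\<beta>}. badly_approximable (\<phi> s)}. (\<Inter>k. alice ?f B k) = {x}"
      if leg: "\<forall>n. bob_legal_upto \<sigma> b {\<alpha>..\<beta>} ?f B n" for B
    proof -
      obtain t where t: "legal_move \<sigma> t {\<alpha>..\<beta>} (B 0)" using leg unfolding bob_legal_upto_def by blast
      define \<rho> where "\<rho> = exp (- \<sigma> * t) * (\<beta> - \<alpha>)"
      have \<rho>: "\<rho> > 0" using ab unfolding \<rho>_def by simp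
      define r where "r k = \<rho> / R ^ k" for k
      have r: "r k > 0" for k using \<rho> R unfolding r_def by simp
      have "\<forall>n. \<exists>x. B n = {x..x + r n} \<and> B n \<subseteq> {\<alpha>..\<beta>}" using bob[where B = B and t = t, OF t] leg unfolding r_def \<rho>_def by blast
      then obtain x where x: "\<And>n. B n = {x n..x n + r n}" "\<And>n. B n \<subseteq> {\<alpha>..\<beta>}" by metis
      have "\<forall>k. \<exists>y. alice ?f B k = {y..y + r k / 4} \<and> {y..y + r k / 4} \<subseteq> {x k..x k + r k}"
        using alice_cases[where B = B, OF x(1) r] by blast
      then obtain y where y: "\<And>k. alice ?f B k = {y k..y k + r k / 4}" "\<And>k. {y k..y k + r k / 4} \<subseteq> B k"
        using x(1) by metis
      have r0: "r \<longlonglongrightarrow> 0" unfolding r_def using R(1) by (rule LIMSEQ_divide_realpow_zero)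
      have "B (Suc k) \<subseteq> alice ?f B k" for k
        using leg unfolding bob_legal_upto_def legal_move_def by (metis lessI)
      then have step: "alice ?f B (Suc k) \<subseteq> alice ?f B k" for k
        using y(1)[of "Suc k"] y(2)[of "Suc k"] by blast
      have "\<exists>z. \<Inter>(range (alice ?f B)) = {z}"
      proof (rule decreasing_closed_nest_sing)
        show "closed (alice ?f B n)" "alice ?f B n \<noteq> {}" for n unfolding y(1) using r[of n] by auto
        show "alice ?f B n \<subseteq> alice ?f B m" if "m \<le> n" for m n
          using that by (rule lift_Suc_antimono_le[where f = "alice ?f B", OF step])
        fix e :: real assume "e > 0"
        then have "\<forall>\<^sub>F n in sequentially. r n < e" by (rule order_tendstoD(2)[OF r0])
        then obtain n where "r n < e" using eventually_happens trivial_limit_sequentially by blast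
        then show "\<exists>n. \<forall>x\<in>alice ?f B n. \<forall>y\<in>alice ?f B n. dist x y < e"
          unfolding y(1) using r[of n] by (intro exI[of _ n]) (auto simp: dist_real_def)
      qed
      then obtain z where z: "(\<Inter>k. alice ?f B k) = {z}" by blast
      then have zk: "z \<in> alice ?f B k" for k by blast
      have zB: "z \<in> {\<alpha>..\<beta>}" using zk[of 0] y[of 0] x(2)[of 0] by blast
      have "\<forall>\<^sub>F n in sequentially. r n < \<delta>" using pos(1) by (rule order_tendstoD(2)[OF r0])
      then obtain k0 where k0: "\<And>k. k \<ge> k0 \<Longrightarrow> r k < \<delta>" unfolding eventually_sequentially by blast
      have "z \<notin> danger \<phi> L R \<epsilon> (r k)" if k: "k \<ge> k0" for k
      proof
        assume dz: "z \<in> danger \<phi> L R \<epsilon> (r k)"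
        have D: "D (B k) = danger \<phi> L R \<epsilon> (r k)" using r[of k] unfolding D_def x(1) by simp
        show False
        proof (cases "{x k..x k + r k / 4} \<inter> danger \<phi> L R \<epsilon> (r k) = {}")
          case True
          then show False using zk[of k] dz alice_evade[where B = B and k = k and D = D, OF x(1) r] unfolding D by auto
        next
          case False
          then obtain s where s: "s \<in> {x k..x k + r k / 4}" "s \<in> danger \<phi> L R \<epsilon> (r k)" by blast
          have z': "z \<in> {x k + 3 * r k / 4..x k + r k}"
            using False zk[of k] alice_evade[where B = B and k = k and D = D, OF x(1) r] unfolding D by auto
          have "s \<in> {\<alpha>..\<beta>}" using s(1) x[of k] r[of k] by (auto simp: subset_iff)
          moreover have "\<bar>s - z\<bar> \<le> r k" using s(1) z' r[of k] by auto
          ultimately have "\<bar>s - z\<bar> \<le> 4 * L * \<epsilon> * R / c * r k"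
            using danger_clusters[OF bl _ zB _ r _ s(2) dz] k0[OF k] R(1) \<epsilon> by simp
          also have "\<dots> \<le> 1 / 4 * r k" using \<epsilon>(3) r[of k] by (intro mult_right_mono) auto
          finally show False using s(1) z' r[of k] by auto
        qed
      qed
      moreover have \<phi>z: "\<phi> z \<in> sphere 0 1" using zB sph by blast
      ultimately have "badly_approximable (\<phi> z)"
        using \<phi>z pos(3) R(1) \<epsilon>(1) \<rho> unfolding r_def
        by (intro avoiding_danger_imp_badly_approximable[where K = k0 and L = L and \<epsilon> = \<epsilon> and \<rho> = \<rho> and R = R]) auto
      then show ?thesis using z zB by blast
    qed
    ultimately show ?thesis unfolding ab_winning_def by blast
  qed
  then show ?thesis unfolding schmidt_winning_def a_winning_def using a(1) by blast
qed

section \<open>Very well approximable parameters\<close>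

text \<open>For every cell of length \<open>r\<close>, the part of \<open>E\<close> in it lies in the interval of radius \<open>\<kappa>\<close> around any one
  of its points.\<close>

lemma clustered_set_covered:
  fixes E :: "real set"
  assumes "a < b" "r > 0" "\<kappa> \<ge> 0" and E: "E \<subseteq> {a..b}"
    and cluster: "\<And>s t. \<lbrakk>s \<in> E; t \<in> E; \<bar>s - t\<bar> \<le> r\<rbrakk> \<Longrightarrow> \<bar>s - t\<bar> \<le> \<kappa>"
  obtains W where "W \<in> lmeasurable" "E \<subseteq> W" "measure lebesgue W \<le> 2 * \<kappa> * ((b - a) / r + 1)"
proof -
  define n where "n = Suc (nat \<lfloor>(b - a) / r\<rfloor>)"
  define cell where "cell s = nat \<lfloor>(s - a) / r\<rfloor>" for s
  \<comment> \<open>Only used for cells that contain a point of \<open>E\<close>; for the others the value is arbitrary.\<close>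
  define pick where "pick j = (SOME s. s \<in> E \<and> cell s = j)" for j
  define W where "W = (\<Union>j<n. {pick j - \<kappa>..pick j + \<kappa>})"
  have "W \<in> lmeasurable" unfolding W_def by (intro fmeasurable.finite_UN) auto
  moreover have "E \<subseteq> W"
  proof
    fix s assume s: "s \<in> E"
    have "(s - a) / r \<le> (b - a) / r" using s E assms(2) by (intro divide_right_mono) auto
    then have "cell s < n" unfolding cell_def n_def by (simp add: less_Suc_eq_le nat_mono floor_mono)
    moreover have "pick (cell s) \<in> E \<and> cell (pick (cell s)) = cell s"
      unfolding pick_def by (rule someI[where x = s]) (simp add: s)
    then have p: "pick (cell s) \<in> E" "cell (pick (cell s)) = cell s" by auto
    have "\<bar>(s - a) / r - (pick (cell s) - a) / r\<bar> \<le> 1"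
    proof -
      have "0 \<le> (s - a) / r" "0 \<le> (pick (cell s) - a) / r"
        using s p(1) E assms(2) by auto
      then have "\<lfloor>(s - a) / r\<rfloor> = \<lfloor>(pick (cell s) - a) / r\<rfloor>"
        using p(2) unfolding cell_def by (simp add: eq_nat_nat_iff)
      then show ?thesis by linarith
    qed
    moreover have "(s - a) / r - (pick (cell s) - a) / r = (s - pick (cell s)) / r"
      by (simp add: diff_divide_distrib)
    ultimately have "\<bar>s - pick (cell s)\<bar> \<le> r" using assms(2) by (simp add: abs_divide)
    then have "\<bar>s - pick (cell s)\<bar> \<le> \<kappa>" using cluster s p(1) by blast
    then have "s \<in> {pick (cell s) - \<kappa>..pick (cell s) + \<kappa>}" by auto
    then show "s \<in> W" using \<open>cell s < n\<close> unfolding W_def by blast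
  qed
  moreover have "measure lebesgue W \<le> 2 * \<kappa> * ((b - a) / r + 1)"
  proof -
    have "measure lebesgue W \<le> (\<Sum>j<n. measure lebesgue {pick j - \<kappa>..pick j + \<kappa>})"
      unfolding W_def by (intro measure_UNION_le) auto
    also have "\<dots> = 2 * \<kappa> * real n" using assms(3) by simp
    also have "\<dots> \<le> 2 * \<kappa> * ((b - a) / r + 1)"
    proof -
      have "0 \<le> (b - a) / r" using assms by simp
      then have "real n \<le> (b - a) / r + 1" unfolding n_def by (simp add: of_nat_nat)
      then show ?thesis using assms(3) by (intro mult_left_mono) auto
    qed
    finally show ?thesis .
  qed
  ultimately show thesis by (rule that)
qed

text \<open>For heights in \<open>[2 ^ l, 2 ^ (l + 1))\<close> the radius \<open>q\<^sup>-\<^sup>1\<^sup>-\<^sup>\<gamma>\<close> is at most \<open>\<theta> ^ l / q\<close> with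
  \<open>\<theta> = 2\<^sup>-\<^sup>\<gamma>\<close>, so the parameters concerned lie in the danger zone with \<open>\<epsilon> = \<theta> ^ l\<close> at the scale
  \<open>r l = 1 / (4 L 2 ^ l)\<close>. For large \<open>l\<close> it consists of \<open>O(1 / r l)\<close> clusters of length
  \<open>O(\<theta> ^ l r l)\<close>, so its measure is \<open>O(\<theta> ^ l)\<close>, and the Borel-Cantelli lemma applies.\<close>

lemma null_set_very_well_approximable:
  fixes \<phi> :: "real \<Rightarrow> real ^ 'm"
  assumes bl: "locally_bilipschitz \<delta> c L {\<alpha>..\<beta>} \<phi>" and ab: "\<alpha> < \<beta>" and \<gamma>: "\<gamma> > 0"
  shows "{s \<in> {\<alpha>..\<beta>}. \<phi> s \<in> approximable (phi (1 + \<gamma>))} \<in> null_sets lebesgue"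
proof -
  have pos: "\<delta> > 0" "c > 0" "L > 0" using bl by (simp_all add: locally_bilipschitz_def)
  define \<theta> where "\<theta> = 2 powr (- \<gamma>)"
  have \<theta>: "0 < \<theta>" "\<theta> < 1" using \<gamma> unfolding \<theta>_def by (simp_all add: powr_less_one)
  define r where "r l = (1 / (4 * L)) / 2 ^ l" for l :: nat
  have r: "r l > 0" "1 / (2 * L * r l) = 2 ^ Suc l" "1 / (2 * L * 2 * r l) = 2 ^ l" for l
    using pos unfolding r_def by simp_all
  define X where "X l = danger \<phi> L 2 (\<theta> ^ l) (r l) \<inter> {\<alpha>..\<beta>}" for l
  have "(\<lambda>l. \<theta> ^ l) \<longlonglongrightarrow> 0" using \<theta> by (intro LIMSEQ_power_zero) simp
  then have ev1: "\<forall>\<^sub>F l in sequentially. \<theta> ^ l < 1 / 16" by (rule order_tendstoD) simp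
  have "r \<longlonglongrightarrow> 0" unfolding r_def by (rule LIMSEQ_divide_realpow_zero) simp
  then have "\<forall>\<^sub>F l in sequentially. r l < \<delta>" by (rule order_tendstoD) (rule pos(1))
  with ev1 have "\<forall>\<^sub>F l in sequentially. \<theta> ^ l < 1 / 16 \<and> r l < \<delta>" by (rule eventually_conj)
  then obtain M where M: "\<And>l. l \<ge> M \<Longrightarrow> \<theta> ^ l < 1 / 16 \<and> r l < \<delta>"
    unfolding eventually_sequentially by blast
  define K where "K = 8 * L / c"
  have K: "K > 0" using pos unfolding K_def by simp
  have "\<exists>W. W \<in> lmeasurable \<and> X (l + M) \<subseteq> W \<and> measure lebesgue W \<le> 2 * K * \<theta> ^ l * (\<beta> - \<alpha> + \<delta>)" for l
  proof -
    let ?l = "l + M"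
    have \<epsilon>: "\<theta> ^ ?l < 1 / 16" "r ?l < \<delta>" "0 < \<theta> ^ ?l" using M[of ?l] \<theta> by auto
    have "\<bar>s - t\<bar> \<le> K * \<theta> ^ ?l * r ?l"
      if "s \<in> X ?l" "t \<in> X ?l" "\<bar>s - t\<bar> \<le> r ?l" for s t
    proof -
      have "\<bar>s - t\<bar> \<le> 4 * L * \<theta> ^ ?l * 2 / c * r ?l"
        using that r(1) \<epsilon> unfolding X_def by (intro danger_clusters[OF bl]) auto
      then show ?thesis unfolding K_def by (simp add: mult_ac)
    qed
    moreover have "0 \<le> K * \<theta> ^ ?l * r ?l" using K \<epsilon> r(1)[of ?l] by simp
    moreover have "X ?l \<subseteq> {\<alpha>..\<beta>}" unfolding X_def by blast
    ultimately obtain W where W: "W \<in> lmeasurable" "X ?l \<subseteq> W"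
        "measure lebesgue W \<le> 2 * (K * \<theta> ^ ?l * r ?l) * ((\<beta> - \<alpha>) / r ?l + 1)"
      using clustered_set_covered[OF ab r(1)] by metis
    note W(3)
    also have "2 * (K * \<theta> ^ ?l * r ?l) * ((\<beta> - \<alpha>) / r ?l + 1) = 2 * K * \<theta> ^ ?l * (\<beta> - \<alpha> + r ?l)"
      using r(1)[of ?l] by (simp add: field_simps)
    also have "\<dots> \<le> 2 * K * \<theta> ^ l * (\<beta> - \<alpha> + \<delta>)"
      using K \<epsilon> \<theta> ab r(1)[of ?l] by (intro mult_mono) (auto intro!: power_decreasing)
    finally show ?thesis using W(1,2) by blast
  qed
  then obtain W where W: "\<And>l. W l \<in> lmeasurable" "\<And>l. X (l + M) \<subseteq> W l"
      "\<And>l. measure lebesgue (W l) \<le> 2 * K * \<theta> ^ l * (\<beta> - \<alpha> + \<delta>)"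
    by metis
  have "limsup W \<in> null_sets lebesgue"
  proof (rule borel_cantelli_limsup1)
    show "W l \<in> sets lebesgue" "emeasure lebesgue (W l) < \<infinity>" for l
      using W(1)[of l] by (auto simp: fmeasurable_def)
    have "summable (\<lambda>l. 2 * K * \<theta> ^ l * (\<beta> - \<alpha> + \<delta>))"
      using \<theta> by (intro summable_mult summable_mult2 summable_geometric) simp
    then show "summable (\<lambda>l. measure lebesgue (W l))"
      by (rule summable_comparison_test') (use W(3) in auto)
  qed
  moreover have "{s \<in> {\<alpha>..\<beta>}. \<phi> s \<in> approximable (phi (1 + \<gamma>))} \<subseteq> limsup W"
  proof
    fix s assume s: "s \<in> {s \<in> {\<alpha>..\<beta>}. \<phi> s \<in> approximable (phi (1 + \<gamma>))}"
    have "\<exists>l\<ge>n. s \<in> W l" for n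
    proof -
      obtain p q where pq: "2 ^ (n + M) < q" "rat_point p q \<in> (sphere 0 1 :: (real ^ 'm) set)"
          "norm (\<phi> s - rat_point p q) < phi (1 + \<gamma>) q"
        using approximable_large_height[of "\<phi> s" "phi (1 + \<gamma>)" "2 ^ (n + M)"] s by blast
      have q0: "1 \<le> q" using pq(1) by simp
      obtain l where l: "2 ^ l \<le> q" "q < 2 ^ (l + 1)" using ex_power_ivl1[of 2 q] q0 by auto
      have "(2::nat) ^ (n + M) < 2 ^ (l + 1)" using pq(1) l(2) by linarith
      then have "n + M < l + 1" by (rule power_less_imp_less_exp[rotated]) simp
      then have nl: "n + M \<le> l" by simp
      have "real q powr (- \<gamma>) \<le> (2 ^ l) powr (- \<gamma>)"
        using l(1) \<gamma> by (intro powr_mono2') auto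
      also have "\<dots> = \<theta> ^ l"
        unfolding \<theta>_def by (simp add: powr_powr mult.commute flip: powr_realpow)
      finally have "real q powr (- \<gamma>) / real q \<le> \<theta> ^ l / real q" by (rule divide_right_mono) simp
      moreover have "- (1 + \<gamma>) = - \<gamma> - 1" by simp
      then have "phi (1 + \<gamma>) q = real q powr (- \<gamma>) / real q"
        unfolding phi_def using q0 by (simp only: powr_diff) simp
      ultimately have "phi (1 + \<gamma>) q \<le> \<theta> ^ l / real q" by simp
      then have "norm (\<phi> s - rat_point p q) < \<theta> ^ l / real q" using pq(3) by simp
      moreover have "2 ^ l \<le> real q" using l by simp
      moreover have "real q < 2 ^ Suc l"
        using l(2) unfolding Suc_eq_plus1 by (simp only: of_nat_less_numeral_power_cancel_iff)
      ultimately have "s \<in> danger \<phi> L 2 (\<theta> ^ l) (r l)"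
        unfolding danger_def mem_Collect_eq r(2,3) using pq(2) q0
        by (intro exI[of _ p] exI[of _ q] conjI) simp_all
      then have "s \<in> X l" unfolding X_def using s by simp
      then have "s \<in> W (l - M)" using W(2)[of "l - M"] nl by auto
      then show ?thesis using nl by (intro exI[of _ "l - M"]) auto
    qed
    then show "s \<in> limsup W" by (auto simp: limsup_INF_SUP)
  qed
  ultimately show ?thesis by (meson null_sets_completion_subset)
qed

section \<open>The three properties together\<close>

theorem corollary3p1:
  fixes \<phi> :: "real \<Rightarrow> real ^ 'm" and \<alpha> \<beta> \<epsilon> :: real and B :: "real set"
  assumes "\<alpha> < \<beta>" and "B = {\<alpha>..\<beta>}"
    and "\<phi> ` B \<subseteq> sphere 0 1"
    and "\<epsilon> > 0" and "C1_holder_on \<epsilon> B \<phi>"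
    and "\<forall>s\<in>B. vector_derivative \<phi> (at s within B) \<noteq> 0"
  shows "hausdorff_dim {s \<in> B. singular_on_average (\<phi> s)} \<le> ennreal (1 / 2) \<and>
    ((\<forall>\<sigma>>0. schmidt_winning \<sigma> B {s \<in> B. badly_approximable (\<phi> s)}) \<and>
     thick_in B {s \<in> B. badly_approximable (\<phi> s)}) \<and>
    (\<forall>\<gamma>>0. {s \<in> B. \<phi> s \<in> approximable (phi (1 + \<gamma>))} \<in> null_sets lebesgue)"
proof -
  have \<alpha>\<beta>: "\<alpha> < \<beta>" and B: "B = {\<alpha>..\<beta>}" and sph: "\<phi> ` {\<alpha>..\<beta>} \<subseteq> sphere 0 1"
    using assms(1-3) by auto
  obtain \<delta> c L where bl: "locally_bilipschitz \<delta> c L {\<alpha>..\<beta>} \<phi>"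
    using C1_imp_locally_bilipschitz[OF \<alpha>\<beta>] assms(5,6) unfolding B by blast
  have "thick_in B {s \<in> B. badly_approximable (\<phi> s)}"
    unfolding thick_in_def
  proof (intro conjI allI impI)
    show "{s \<in> B. badly_approximable (\<phi> s)} \<subseteq> B" by blast
    fix U assume U: "openin (top_of_set B) U \<and> U \<noteq> {}"
    then obtain u v where uv: "u < v" "{u..v} \<subseteq> U"
      using relatively_open_contains_interval[OF \<alpha>\<beta>] unfolding B by blast
    have UB: "U \<subseteq> B" using U openin_imp_subset by blast
    let ?S = "{s \<in> B. badly_approximable (\<phi> s)} \<inter> U"
    have "1 \<le> hausdorff_dim ?S"
    proof (rule hausdorff_dim_badly_approximable_ge_1[OF bl sph uv(1)])
      show "{u..v} \<subseteq> {\<alpha>..\<beta>}" using uv(2) UB unfolding B by blast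
      show "{s \<in> {u..v}. badly_approximable (\<phi> s)} \<subseteq> ?S" using uv(2) UB by blast
    qed
    moreover have "hausdorff_dim ?S \<le> hausdorff_dim B" by (rule hausdorff_dim_mono) blast
    moreover have "hausdorff_dim B \<le> 1" unfolding B by (rule hausdorff_dim_interval_le_1)
    ultimately show "hausdorff_dim ?S = hausdorff_dim B" by (meson antisym order_trans)
  qed
  then show ?thesis
    using hausdorff_dim_singular_on_average[OF bl]
      schmidt_winning_badly_approximable[OF bl sph \<alpha>\<beta>]
      null_set_very_well_approximable[OF bl \<alpha>\<beta>]
    unfolding B by blast
qed

end
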